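(* Let $k$ be a field, $\alpha,\beta,\gamma\in\mathcal A$, $\mathfrak a\in Q_\alpha\backslash\mathrm{GL}(2\infty,k)/Q_\beta$ and $\mathfrak b\in Q_\beta\backslash\mathrm{GL}(2\infty,k)/Q_\gamma$. Then: (a) $\chi(\mathfrak a\star\mathfrak b)=\chi(\mathfrak a)\,\chi(\mathfrak b)$ (product of linear relations); (b) $\eta(\mathfrak a\star\mathfrak b)=\eta(\mathfrak a)+\eta(\mathfrak b)+\dim\bigl(\operatorname{indef}\chi(\mathfrak b)/(\operatorname{indef}\chi(\mathfrak b)\cap\operatorname{dom}\chi(\mathfrak a))\bigr)$; (c) $\chi(\mathfrak a^* )=\chi(\mathfrak a)^\square$ and $\eta(\mathfrak a^* )=\eta(\mathfrak a)+\dim\operatorname{indef}\chi(\mathfrak a)-\dim\ker\chi(\mathfrak a)-\beta_-+\alpha_-$.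
   Context: $\mathrm{GL}(2\infty,k)$ is the group of invertible two-sided infinite matrices $g=(g_{ij})_{i,j\in\mathbb Z}$ over $k$ such that $g-1$ has only finitely many nonzero entries; it acts on the space $k^{2\infty}$ of finitely supported columns $(v_j)_{j\in\mathbb Z}$. $\mathcal A$ is the set of pairs $\alpha=(\alpha_-,\alpha_+)$ of integers with $\alpha_-\le\alpha_+$, and $|\alpha|=\alpha_+-\alpha_-$. For $\alpha\in\mathcal A$ decompose $k^{2\infty}=k_\alpha^-\oplus k_\alpha\oplus k_\alpha^+$, the summands consisting of sequences supported on $j\le\alpha_-$, on $\alpha_-<j\le\alpha_+$, and on $j>\alpha_+$. $Q_\alpha$ is the subgroup of matrices having in this decomposition the block form $\begin{pmatrix} * & * & * \\ 0 & 1 & * \\ 0 & 0 & * \end{pmatrix}$. Linear relations. A linear relation $P:V\rightrightarrows W$ is a linear subspace of $V\oplus W$. The product of $P:V\rightrightarrows W$ and $Q:W\rightrightarrows Y$ is $QP:V\rightrightarrows Y$, the set of $(v,y)$ for which there is $w\in W$ with $(v,w)\in P$, $(w,y)\in Q$. $\ker P=P\cap V$; $\operatorname{dom}P$ is the projection of $P$ to $V$; $\operatorname{indef}P=P\cap W$; $P^\square:W\rightrightarrows V$ is the set of $(w,v)$ with $(v,w)\in P$. Invariants. For $A\in\mathrm{GL}(2\infty,k)$ write $A=(a_{ij})_{1\le i,j\le 3}$ in block form, rows split according to $k^-_\alpha\oplus k_\alpha\oplus k^+_\alpha$ and columns according to $k^-_\beta\oplus k_\beta\oplus k^+_\beta$.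 $\chi(A):k_\beta\rightrightarrows k_\alpha$ is the set of all $(v,u)\in k_\beta\oplus k_\alpha$ for which there exist $x\in k_\alpha^-$, $y\in k_\beta^-$ with $\begin{pmatrix} x \\ u \\ 0 \end{pmatrix}=A\begin{pmatrix} y \\ v \\ 0 \end{pmatrix}$. It depends only on the double coset $\mathfrak a=Q_\alpha A Q_\beta$ and is denoted $\chi(\mathfrak a)$; also $\eta(\mathfrak a):=\operatorname{rk}a_{31}$, which depends only on $\mathfrak a$. Involution. $\mathfrak a^*\in Q_\beta\backslash\mathrm{GL}(2\infty,k)/Q_\alpha$ is the double coset of $A^{-1}$, $A\in\mathfrak a$. Product. Let $A\in\mathfrak a\in Q_\alpha\backslash \mathrm{GL}(2\infty,k)/Q_\beta$ and $B\in\mathfrak b\in Q_\beta\backslash \mathrm{GL}(2\infty,k)/Q_\gamma$. Choose integers $N_\pm,M_\pm,K_\pm\ge0$ with $\alpha_--N_-=\beta_--M_-=\gamma_--K_-=:s$ and $\alpha_++N_+=\beta_++M_+=\gamma_++K_+=:t$, such that all entries of $A$ and $B$ outside the square $s<i,j\le t$ are those of the identity matrix. Write the finite square part of $A$ as $(a_{ij})_{1\le i,j\le 3}$ with row sizes $N_-,|\alpha|,N_+$ and column sizes $M_-,|\beta|,M_+$, and that of $B$ as $(b_{ij})$ with row sizes $M_-,|\beta|,M_+$ and column sizes $K_-,|\gamma|,K_+$. Put $$A^\circ=\begin{pmatrix} 1_{M_-} & 0 & 0 & 0 & 0 \\ 0 & a_{11} & a_{12} & a_{13} & 0 \\ 0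 & a_{21} & a_{22} & a_{23} & 0 \\ 0 & a_{31} & a_{32} & a_{33} & 0 \\ 0 & 0 & 0 & 0 & 1_{M_+} \end{pmatrix},\qquad B^\lozenge=\begin{pmatrix} b_{11} & 0 & b_{12} & 0 & b_{13} \\ 0 & 1_{M_-} & 0 & 0 & 0 \\ b_{21} & 0 & b_{22} & 0 & b_{23} \\ 0 & 0 & 0 & 1_{M_+} & 0 \\ b_{31} & 0 & b_{32} & 0 & b_{33} \end{pmatrix}.$$ Then $\mathfrak a\star\mathfrak b\in Q_\alpha\backslash\mathrm{GL}(2\infty,k)/Q_\gamma$ is the double coset of the matrix obtained by placing $A^\circ B^\lozenge$ at the index range $s-M_-<i,j\le t+M_+$ and completing it by the identity outside; it is independent of the choices. *)

theory Defs
  imports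
    "Jordan_Normal_Form.Matrix"
    "HOL-Algebra.Coset"
    "HOL-Library.Function_Algebras"
    "HOL-Library.Groups_Big_Fun"
begin

section \<open>The group GL(2\<infinity>,k) and its action on columns\<close>

type_synonym 'k imat = "int \<Rightarrow> int \<Rightarrow> 'k"
type_synonym 'k col = "int \<Rightarrow> 'k"

definition imat_one :: "'k::field imat" where
  "imat_one = (\<lambda>i j. if i = j then 1 else 0)"

definition imat_mult :: "'k::field imat \<Rightarrow> 'k imat \<Rightarrow> 'k imat" where
  "imat_mult A B = (\<lambda>i j. Sum_any (\<lambda>m. A i m * B m j))"

text \<open>The sums above are finite on the carrier of the following monoid: its members differ from
  the identity in finitely many entries.\<close>

definition finitary_monoid :: "'k::field imat monoid" where
  "finitary_monoid =
     \<lparr>carrier = {A. finite {(i, j). A i j \<noteq> imat_one i j}}, mult = imat_mult, one = imat_one\<rparr>"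

definition GL :: "'k::field imat monoid" where
  "GL = units_of finitary_monoid"

definition act :: "'k::field imat \<Rightarrow> 'k col \<Rightarrow> 'k col" where
  "act A v = (\<lambda>i. Sum_any (\<lambda>j. A i j * v j))"

definition col_scale :: "'k::field \<Rightarrow> 'k col \<Rightarrow> 'k col" where
  "col_scale c v = (\<lambda>j. c * v j)"

interpretation col: vector_space "col_scale :: 'k::field \<Rightarrow> 'k col \<Rightarrow> 'k col"
  by unfold_locales (auto simp: col_scale_def fun_eq_iff algebra_simps)


section \<open>Index pairs, the decomposition of columns, and the subgroups Q\<close>

text \<open>A pair \<open>\<alpha> = (\<alpha>\<^sub>-, \<alpha>\<^sub>+)\<close> has \<open>fst \<alpha> = \<alpha>\<^sub>-\<close> and \<open>snd \<alpha> = \<alpha>\<^sub>+\<close>.\<close>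

definition index_pairs :: "(int \<times> int) set" where
  "index_pairs = {\<alpha>. fst \<alpha> \<le> snd \<alpha>}"

definition width :: "int \<times> int \<Rightarrow> nat" where
  "width \<alpha> = nat (snd \<alpha> - fst \<alpha>)"

text \<open>The summands are subspaces of the space of columns, so that the block column with entries
  \<open>x\<close>, \<open>u\<close>, \<open>z\<close> is the sum \<open>x + u + z\<close>.\<close>

definition col_minus :: "int \<times> int \<Rightarrow> 'k::field col set" where
  "col_minus \<alpha> = {v. finite {j. v j \<noteq> 0} \<and> (\<forall>j. v j \<noteq> 0 \<longrightarrow> j \<le> fst \<alpha>)}"

definition col_mid :: "int \<times> int \<Rightarrow> 'k::field col set" where
  "col_mid \<alpha> = {v. finite {j. v j \<noteq> 0} \<and> (\<forall>j. v j \<noteq> 0 \<longrightarrow> fst \<alpha> < j \<and> j \<le> snd \<alpha>)}"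

definition Q :: "int \<times> int \<Rightarrow> 'k::field imat set" where
  "Q \<alpha> = {g \<in> carrier GL.
     (\<forall>i j. fst \<alpha> < i \<and> j \<le> fst \<alpha> \<longrightarrow> g i j = 0) \<and>
     (\<forall>i j. snd \<alpha> < i \<and> j \<le> snd \<alpha> \<longrightarrow> g i j = 0) \<and>
     (\<forall>i j. fst \<alpha> < i \<and> i \<le> snd \<alpha> \<and> fst \<alpha> < j \<and> j \<le> snd \<alpha> \<longrightarrow> g i j = imat_one i j)}"

definition dcoset :: "int \<times> int \<Rightarrow> int \<times> int \<Rightarrow> 'k::field imat \<Rightarrow> 'k imat set" where
  "dcoset \<alpha> \<beta> A = (Q \<alpha> #>\<^bsub>GL\<^esub> A) <#>\<^bsub>GL\<^esub> Q \<beta>"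

definition dcosets :: "int \<times> int \<Rightarrow> int \<times> int \<Rightarrow> 'k::field imat set set" where
  "dcosets \<alpha> \<beta> = dcoset \<alpha> \<beta> ` carrier GL"


section \<open>Linear relations\<close>

text \<open>A relation from \<open>V\<close> to \<open>W\<close> is a set of pairs \<open>(v, w)\<close>. Its domain is \<^const>\<open>Domain\<close>, its
  transpose is \<^const>\<open>converse\<close>.\<close>

definition lrel_prod :: "('b \<times> 'c) set \<Rightarrow> ('a \<times> 'b) set \<Rightarrow> ('a \<times> 'c) set" where
  "lrel_prod S R = R O S"

definition lrel_ker :: "('a \<times> 'b::zero) set \<Rightarrow> 'a set" where
  "lrel_ker R = {v. (v, 0) \<in> R}"

definition lrel_indef :: "('a::zero \<times> 'b) set \<Rightarrow> 'b set" where
  "lrel_indef R = {w. (0, w) \<in> R}"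

text \<open>The classes of the elements of \<open>B\<close> are distinct and form a basis of the quotient of \<open>U\<close>
  by \<open>W\<close>.\<close>

definition basis_modulo :: "'k::field col set \<Rightarrow> 'k col set \<Rightarrow> 'k col set \<Rightarrow> bool" where
  "basis_modulo U W B \<longleftrightarrow> finite B \<and> B \<subseteq> U \<and>
     (\<forall>u\<in>U. \<exists>c. u - (\<Sum>b\<in>B. col_scale (c b) b) \<in> W) \<and>
     (\<forall>c. (\<Sum>b\<in>B. col_scale (c b) b) \<in> W \<longrightarrow> (\<forall>b\<in>B. c b = 0))"

definition quot_dim :: "'k::field col set \<Rightarrow> 'k col set \<Rightarrow> nat" where
  "quot_dim U W = (THE n. \<exists>B. basis_modulo U W B \<and> card B = n)"


section \<open>The invariants\<close>

definition chi_mat :: "int \<times> int \<Rightarrow> int \<times> int \<Rightarrow> 'k::field imat \<Rightarrow> ('k col \<times> 'k col) set" where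
  "chi_mat \<alpha> \<beta> A = {(v, u). v \<in> col_mid \<beta> \<and> u \<in> col_mid \<alpha> \<and>
     (\<exists>x\<in>col_minus \<alpha>. \<exists>y\<in>col_minus \<beta>. x + u = act A (y + v))}"

definition rk :: "'k::field imat \<Rightarrow> nat" where
  "rk M = col.dim (range (\<lambda>j i. M i j))"

definition block31 :: "int \<times> int \<Rightarrow> int \<times> int \<Rightarrow> 'k::field imat \<Rightarrow> 'k imat" where
  "block31 \<alpha> \<beta> A = (\<lambda>i j. if snd \<alpha> < i \<and> j \<le> fst \<beta> then A i j else 0)"

definition eta_mat :: "int \<times> int \<Rightarrow> int \<times> int \<Rightarrow> 'k::field imat \<Rightarrow> nat" where
  "eta_mat \<alpha> \<beta> A = rk (block31 \<alpha> \<beta> A)"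

text \<open>The functions of double cosets below are the common values on the representatives.\<close>

definition chi :: "int \<times> int \<Rightarrow> int \<times> int \<Rightarrow> 'k::field imat set \<Rightarrow> ('k col \<times> 'k col) set" where
  "chi \<alpha> \<beta> \<aa> = the_elem (chi_mat \<alpha> \<beta> ` \<aa>)"

definition eta :: "int \<times> int \<Rightarrow> int \<times> int \<Rightarrow> 'k::field imat set \<Rightarrow> nat" where
  "eta \<alpha> \<beta> \<aa> = the_elem (eta_mat \<alpha> \<beta> ` \<aa>)"

definition star_inv :: "int \<times> int \<Rightarrow> int \<times> int \<Rightarrow> 'k::field imat set \<Rightarrow> 'k imat set" where
  "star_inv \<alpha> \<beta> \<aa> = the_elem ((\<lambda>A. dcoset \<beta> \<alpha> (inv\<^bsub>GL\<^esub> A)) ` \<aa>)"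


section \<open>The product of double cosets\<close>

text \<open>\<open>block_mat rs cs Bs\<close> assembles the matrix with row sizes \<open>rs\<close>, column sizes \<open>cs\<close> and blocks
  \<open>Bs ! p ! q\<close>; \<open>locate rs i\<close> is the number of the block containing \<open>i\<close> together with the
  position inside this block. The entries of a block beyond its size are never read.\<close>

fun locate :: "nat list \<Rightarrow> nat \<Rightarrow> nat \<times> nat" where
  "locate [] i = (0, i)"
| "locate (r # rs) i = (if i < r then (0, i) else apfst Suc (locate rs (i - r)))"

definition block_mat ::
    "nat list \<Rightarrow> nat list \<Rightarrow> (nat \<Rightarrow> nat \<Rightarrow> 'k) list list \<Rightarrow> 'k mat" where
  "block_mat rs cs Bs = mat (sum_list rs) (sum_list cs)
     (\<lambda>(i, j). case (locate rs i, locate cs j) of ((p, i'), (q, j')) \<Rightarrow> (Bs ! p ! q) i' j')"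

definition zero_block :: "nat \<Rightarrow> nat \<Rightarrow> 'k::field" where
  "zero_block = (\<lambda>i j. 0)"

definition one_block :: "nat \<Rightarrow> nat \<Rightarrow> 'k::field" where
  "one_block = (\<lambda>i j. if i = j then 1 else 0)"

text \<open>The block of \<open>A\<close> whose first entry has row \<open>r + 1\<close> and column \<open>c + 1\<close>.\<close>

definition sub_block :: "'k imat \<Rightarrow> int \<Rightarrow> int \<Rightarrow> nat \<Rightarrow> nat \<Rightarrow> 'k" where
  "sub_block A r c = (\<lambda>i j. A (r + 1 + int i) (c + 1 + int j))"

definition circ_mat ::
    "int \<times> int \<Rightarrow> int \<times> int \<Rightarrow> int \<Rightarrow> int \<Rightarrow> 'k::field imat \<Rightarrow> 'k mat" where
  "circ_mat \<alpha> \<beta> s t A =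
    (let Nm = nat (fst \<alpha> - s); Np = nat (t - snd \<alpha>);
         Mm = nat (fst \<beta> - s); Mp = nat (t - snd \<beta>);
         Z = zero_block; E = one_block;
         a11 = sub_block A s s; a12 = sub_block A s (fst \<beta>); a13 = sub_block A s (snd \<beta>);
         a21 = sub_block A (fst \<alpha>) s; a22 = sub_block A (fst \<alpha>) (fst \<beta>);
         a23 = sub_block A (fst \<alpha>) (snd \<beta>);
         a31 = sub_block A (snd \<alpha>) s; a32 = sub_block A (snd \<alpha>) (fst \<beta>);
         a33 = sub_block A (snd \<alpha>) (snd \<beta>)
     in block_mat [Mm, Nm, width \<alpha>, Np, Mp] [Mm, Mm, width \<beta>, Mp, Mp]
          [[E, Z,   Z,   Z,   Z],
           [Z, a11, a12, a13, Z],
           [Z, a21, a22, a23, Z],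
           [Z, a31, a32, a33, Z],
           [Z, Z,   Z,   Z,   E]])"

definition lozenge_mat ::
    "int \<times> int \<Rightarrow> int \<times> int \<Rightarrow> int \<Rightarrow> int \<Rightarrow> 'k::field imat \<Rightarrow> 'k mat" where
  "lozenge_mat \<beta> \<gamma> s t B =
    (let Mm = nat (fst \<beta> - s); Mp = nat (t - snd \<beta>);
         Km = nat (fst \<gamma> - s); Kp = nat (t - snd \<gamma>);
         Z = zero_block; E = one_block;
         b11 = sub_block B s s; b12 = sub_block B s (fst \<gamma>); b13 = sub_block B s (snd \<gamma>);
         b21 = sub_block B (fst \<beta>) s; b22 = sub_block B (fst \<beta>) (fst \<gamma>);
         b23 = sub_block B (fst \<beta>) (snd \<gamma>);
         b31 = sub_block B (snd \<beta>) s; b32 = sub_block B (snd \<beta>) (fst \<gamma>);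
         b33 = sub_block B (snd \<beta>) (snd \<gamma>)
     in block_mat [Mm, Mm, width \<beta>, Mp, Mp] [Km, Mm, width \<gamma>, Mp, Kp]
          [[b11, Z, b12, Z, b13],
           [Z,   E, Z,   Z, Z],
           [b21, Z, b22, Z, b23],
           [Z,   Z, Z,   E, Z],
           [b31, Z, b32, Z, b33]])"

text \<open>The infinite matrix with \<open>M\<close> at the index range \<open>p < i, j \<le> q\<close>, completed by the identity.\<close>

definition place :: "int \<Rightarrow> int \<Rightarrow> 'k::field mat \<Rightarrow> 'k imat" where
  "place p q M = (\<lambda>i j. if p < i \<and> i \<le> q \<and> p < j \<and> j \<le> q
     then M $$ (nat (i - p - 1), nat (j - p - 1)) else imat_one i j)"

definition star_mat :: "int \<times> int \<Rightarrow> int \<times> int \<Rightarrow> int \<times> int \<Rightarrow> int \<Rightarrow> int \<Rightarrow>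
    'k::field imat \<Rightarrow> 'k imat \<Rightarrow> 'k imat" where
  "star_mat \<alpha> \<beta> \<gamma> s t A B =
     place (s - (fst \<beta> - s)) (t + (t - snd \<beta>)) (circ_mat \<alpha> \<beta> s t A * lozenge_mat \<beta> \<gamma> s t B)"

definition one_outside :: "int \<Rightarrow> int \<Rightarrow> 'k::field imat \<Rightarrow> bool" where
  "one_outside s t A \<longleftrightarrow>
     (\<forall>i j. \<not> (s < i \<and> i \<le> t \<and> s < j \<and> j \<le> t) \<longrightarrow> A i j = imat_one i j)"

definition star_choice :: "int \<times> int \<Rightarrow> int \<times> int \<Rightarrow> int \<times> int \<Rightarrow>
    'k::field imat set \<Rightarrow> 'k imat set \<Rightarrow> int \<Rightarrow> int \<Rightarrow> 'k imat \<Rightarrow> 'k imat \<Rightarrow> bool" where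
  "star_choice \<alpha> \<beta> \<gamma> \<aa> \<bb> s t A B \<longleftrightarrow> A \<in> \<aa> \<and> B \<in> \<bb> \<and>
     s \<le> fst \<alpha> \<and> s \<le> fst \<beta> \<and> s \<le> fst \<gamma> \<and> snd \<alpha> \<le> t \<and> snd \<beta> \<le> t \<and> snd \<gamma> \<le> t \<and>
     one_outside s t A \<and> one_outside s t B"

text \<open>The double coset of \<^const>\<open>star_mat\<close> is the same for all choices of the representatives and
  of \<open>s\<close>, \<open>t\<close>; the definition takes an arbitrary admissible choice.\<close>

definition star :: "int \<times> int \<Rightarrow> int \<times> int \<Rightarrow> int \<times> int \<Rightarrow>
    'k::field imat set \<Rightarrow> 'k imat set \<Rightarrow> 'k imat set" where
  "star \<alpha> \<beta> \<gamma> \<aa> \<bb> =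
     (case SOME (s, t, A, B). star_choice \<alpha> \<beta> \<gamma> \<aa> \<bb> s t A B of
        (s, t, A, B) \<Rightarrow> dcoset \<alpha> \<gamma> (star_mat \<alpha> \<beta> \<gamma> s t A B))"

end

theory Submission
  imports Defs
begin

text \<open>
  Matrices are read as maps on columns. If the rows of \<open>A\<close> are split according to \<open>\<alpha>\<close> and the
  columns according to \<open>\<beta>\<close>, then \<open>\<eta>(A)\<close> is the rank of the map that takes a column
  supported on \<open>j \<le> \<beta>\<^sub>-\<close> to the part of its image above \<open>\<alpha>\<^sub>+\<close>
  (\<open>eta_mat_eq_dim\<close>). Elements of \<open>Q\<close> are the \<open>g\<close> that preserve the flag of columns supported on
  \<open>j \<le> \<alpha>\<^sub>-\<close> and on \<open>j \<le> \<alpha>\<^sub>+\<close> and act trivially between its two members (\<open>Q_iff\<close>), whence the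
  invariance of \<open>\<chi>\<close> and \<open>\<eta>\<close> (\<open>invariants_dcoset\<close>).

  The matrix \<open>A\<^sup>\<circ>\<close> is just a larger window of \<open>A\<close>, and \<open>B\<^sup>\<lozenge>\<close> is a window of \<open>B\<close> with permuted rows and
  columns. The permutation of the columns stays within the blocks for \<open>\<gamma>\<close> and fixes the middle one, so it
  changes neither invariant. Thus the product is represented by \<open>A \<sigma> B\<close> (\<open>act_star\<close>), where the involution \<open>\<sigma>\<close>
  fixes the middle block for \<open>\<beta>\<close> and moves the parts of the square \<open>s < j \<le> t\<close> to the left and to
  the right of this block out of the square. There \<open>A\<close> and \<open>B\<close> are the identity. So between the
  factors only the middle part is passed on: the minus part that \<open>B\<close> produces is stored away, the minus part
  that \<open>A\<close> uses is arbitrary, and a plus part that \<open>B\<close> produces can no longer be cancelled.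

  With \<open>couple_solutions\<close> and \<open>decouple_solution\<close>, which express this, the relation of the product is
  the product of the relations (\<open>chi_mat_star\<close>). For \<open>\<eta>\<close> of the product (\<open>eta_mat_star\<close>) the plus part
  stored by \<open>\<sigma>\<close> contributes \<open>\<eta>(B)\<close>. The vectors without such a part form the sum of the image of
  \<open>a\<^sub>3\<^sub>1\<close>, which contributes \<open>\<eta>(A)\<close>, and of the image of the indefiniteness of \<open>\<chi>(B)\<close>, which contributes
  its dimension modulo the domain of \<open>\<chi>(A)\<close> (\<open>dim_sum_image\<close>).

  For the inverse, \<open>A (y + v) = x + u\<close> means \<open>A\<inverse> (x + u) = y + v\<close>, so the relation is transposed.
  Rank-nullity shows that \<open>\<eta>(A)\<close>, the dimension of the indefiniteness and the dimension of the space of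
  those \<open>y\<close> in the minus space whose image lies in the minus space add up to the dimension
  \<open>\<beta>\<^sub>- - s\<close> of the minus space truncated at \<open>s\<close> (\<open>eta_mat_plus_indef\<close>). For \<open>A\<inverse>\<close> the
  third space is the image under \<open>A\<close> of the one for \<open>A\<close>, and the indefiniteness becomes the kernel; the
  difference of the two equations is the formula (\<open>eta_mat_inverse\<close>).
\<close>

section \<open>Dimensions of quotients and of images\<close>

definition fin_dim :: "'k::field col set \<Rightarrow> bool" where
  "fin_dim U \<longleftrightarrow> (\<exists>S. finite S \<and> U \<subseteq> col.span S)"

lemma fin_dim_subset: "fin_dim U \<Longrightarrow> V \<subseteq> U \<Longrightarrow> fin_dim V"
  unfolding fin_dim_def by blast

lemma finite_imp_fin_dim: "finite S \<Longrightarrow> fin_dim S"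
  unfolding fin_dim_def using col.span_superset by blast

lemma fin_dim_image:
  assumes f: "Vector_Spaces.linear col_scale col_scale f" and "fin_dim U"
  shows "fin_dim (f ` U)"
proof -
  interpret f: Vector_Spaces.linear col_scale col_scale f by (fact f)
  obtain S where "finite S" "U \<subseteq> col.span S" using assms(2) unfolding fin_dim_def by blast
  then have "finite (f ` S)" "f ` U \<subseteq> col.span (f ` S)" by (auto simp: f.span_image)
  then show ?thesis unfolding fin_dim_def by blast
qed

lemma subspace_image:
  assumes f: "Vector_Spaces.linear col_scale col_scale f" and "col.subspace U"
  shows "col.subspace (f ` U)"
proof -
  interpret f: Vector_Spaces.linear col_scale col_scale f by (fact f)
  show ?thesis using assms(2) by (rule f.subspace_image)
qed

lemma subspace_preimage:
  assumes f: "Vector_Spaces.linear col_scale col_scale f"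
    and "col.subspace I" "col.subspace W"
  shows "col.subspace {v \<in> I. f v \<in> W}"
proof -
  interpret f: Vector_Spaces.linear col_scale col_scale f by (fact f)
  show ?thesis using assms(2,3) unfolding col.subspace_def
    by (auto simp: f.zero f.add f.scale)
qed

text \<open>Extend a basis of \<open>W\<close> to one of \<open>U\<close>: the added vectors form a basis of the quotient.\<close>

lemma basis_modulo_exists:
  assumes W: "col.subspace W" and WU: "W \<subseteq> U" and U: "fin_dim U"
  obtains B where "basis_modulo U W B"
proof -
  obtain C where C: "C \<subseteq> W" "col.independent C" "W \<subseteq> col.span C"
    using col.maximal_independent_subset by blast
  have "C \<subseteq> U" using C WU by blast
  then obtain D where D: "C \<subseteq> D" "D \<subseteq> U" "col.independent D" "U \<subseteq> col.span D"
    using col.maximal_independent_subset_extend[OF _ C(2)] by blast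
  have fin: "finite D"
    using U D(2,3) col.independent_span_bound unfolding fin_dim_def by (meson order_trans)
  have finC: "finite C" using fin D(1) finite_subset by blast
  have spC: "col.span C = W" using C W by (simp add: col.span_subspace)
  have split: "(\<Sum>b\<in>D. col_scale (c b) b)
      = (\<Sum>b\<in>C. col_scale (c b) b) + (\<Sum>b\<in>D - C. col_scale (c b) b)" for c
    using sum.subset_diff[OF D(1) fin, of "\<lambda>b. col_scale (c b) b"] by (simp add: add.commute)
  have "basis_modulo U W (D - C)" unfolding basis_modulo_def
  proof (intro conjI ballI allI impI)
    show "finite (D - C)" "D - C \<subseteq> U" using fin D(2) by auto
  next
    fix u assume "u \<in> U"
    then have "u \<in> col.span D" using D by blast
    then obtain c where c: "u = (\<Sum>b\<in>D. col_scale (c b) b)"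
      using fin by (auto simp: col.span_finite)
    have "(\<Sum>b\<in>C. col_scale (c b) b) \<in> col.span C"
      by (intro col.span_sum col.span_scale col.span_base)
    then show "\<exists>c. u - (\<Sum>b\<in>D - C. col_scale (c b) b) \<in> W"
      unfolding spC by (intro exI[of _ c]) (simp add: c split)
  next
    fix c b assume m: "(\<Sum>b\<in>D - C. col_scale (c b) b) \<in> W" and b: "b \<in> D - C"
    then obtain d where d: "(\<Sum>b\<in>D - C. col_scale (c b) b) = (\<Sum>b\<in>C. col_scale (d b) b)"
      using finC spC by (auto simp: col.span_finite)
    define e where "e b = (if b \<in> C then - d b else c b)" for b
    have "(\<Sum>b\<in>C. col_scale (e b) b) = - (\<Sum>b\<in>C. col_scale (d b) b)"
      by (simp add: e_def sum_negf[symmetric] cong: sum.cong)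
    moreover have "(\<Sum>b\<in>D - C. col_scale (e b) b) = (\<Sum>b\<in>D - C. col_scale (c b) b)"
      by (rule sum.cong) (auto simp: e_def)
    ultimately have "(\<Sum>b\<in>D. col_scale (e b) b) = 0" using d by (simp add: split)
    then have "e b = 0"
      using D(3) fin b by (auto simp: col.dependent_finite)
    then show "c b = 0" using b by (simp add: e_def)
  qed
  then show ?thesis by (rule that)
qed

text \<open>Representatives of a basis of the quotient, adjoined to a basis of \<open>W\<close>, give a basis of \<open>U\<close>.\<close>

lemma dim_add_card_basis_modulo:
  assumes U: "col.subspace U" and W: "col.subspace W" and WU: "W \<subseteq> U" and fin: "fin_dim W"
    and B: "basis_modulo U W B"
  shows "col.dim U = col.dim W + card B"
proof -
  obtain C where C: "C \<subseteq> W" "col.independent C" "W \<subseteq> col.span C" "card C = col.dim W"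
    using col.basis_exists by blast
  have finC: "finite C"
    using fin C(1,2) col.independent_span_bound unfolding fin_dim_def by (meson order_trans)
  have spC: "col.span C = W" using C W by (simp add: col.span_subspace)
  have finB: "finite B" and BU: "B \<subseteq> U" using B by (auto simp: basis_modulo_def)
  have indB: "\<And>c b. (\<Sum>b\<in>B. col_scale (c b) b) \<in> W \<Longrightarrow> b \<in> B \<Longrightarrow> c b = 0"
    using B by (auto simp: basis_modulo_def)
  have disj: "C \<inter> B = {}"
  proof (rule ccontr)
    assume "C \<inter> B \<noteq> {}"
    then obtain b where b: "b \<in> C" "b \<in> B" by blast
    \<comment> \<open>A common element would be a combination of \<open>B\<close> with coefficient 1 that lies in \<open>W\<close>.\<close>
    define c where "c x = (if x = b then 1 else 0 :: 'a)" for x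
    have "(\<Sum>x\<in>B. col_scale (c x) x) = (\<Sum>x\<in>B. if x = b then x else 0)"
      by (rule sum.cong) (auto simp: c_def)
    also have "\<dots> = b" using b finB by (simp)
    finally have "c b = 0" using indB[of c b] b C(1) by auto
    then show False by (simp add: c_def)
  qed
  have split: "(\<Sum>b\<in>C \<union> B. col_scale (c b) b)
      = (\<Sum>b\<in>C. col_scale (c b) b) + (\<Sum>b\<in>B. col_scale (c b) b)" for c
    by (rule sum.union_disjoint[OF finC finB disj])
  have ind: "col.independent (C \<union> B)"
  proof (subst col.dependent_finite)
    show "finite (C \<union> B)" using finC finB by simp
    show "\<not> (\<exists>u. (\<exists>v\<in>C \<union> B. u v \<noteq> 0) \<and> (\<Sum>v\<in>C \<union> B. col_scale (u v) v) = 0)"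
    proof (clarify)
      fix u v assume v: "v \<in> C \<union> B" and nz: "u v \<noteq> 0"
        and z: "(\<Sum>v\<in>C \<union> B. col_scale (u v) v) = 0"
      have mem: "(\<Sum>b\<in>C. col_scale (u b) b) \<in> W"
        unfolding spC[symmetric] by (intro col.span_sum col.span_scale col.span_base)
      have "(\<Sum>b\<in>B. col_scale (u b) b) = - (\<Sum>b\<in>C. col_scale (u b) b)"
        using z unfolding split by (simp add: eq_neg_iff_add_eq_0 add.commute)
      then have "(\<Sum>b\<in>B. col_scale (u b) b) \<in> W" using mem W by (simp add: col.subspace_neg)
      then have uB: "\<And>b. b \<in> B \<Longrightarrow> u b = 0" using indB by blast
      then have "(\<Sum>b\<in>C. col_scale (u b) b) = 0" using z unfolding split by simp
      then have "\<And>b. b \<in> C \<Longrightarrow> u b = 0"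
        using C(2) finC by (auto simp: col.dependent_finite)
      then show False using v nz uB by blast
    qed
  qed
  have sp: "U \<subseteq> col.span (C \<union> B)"
  proof
    fix u assume "u \<in> U"
    then obtain c where c: "u - (\<Sum>b\<in>B. col_scale (c b) b) \<in> W" (is "u - ?s \<in> W")
      using B by (auto simp: basis_modulo_def)
    have "u - ?s \<in> col.span (C \<union> B)"
      using c spC col.span_mono[of C "C \<union> B"] by blast
    moreover have "?s \<in> col.span (C \<union> B)"
      by (intro col.span_sum col.span_scale col.span_base) simp
    ultimately have "(u - ?s) + ?s \<in> col.span (C \<union> B)" by (rule col.span_add)
    then show "u \<in> col.span (C \<union> B)" by simp
  qed
  have "card (C \<union> B) = col.dim U"
    using C(1) WU BU sp ind by (intro col.basis_card_eq_dim) auto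
  then show ?thesis using card_Un_disjoint[OF finC finB disj] C(4) by simp
qed

text \<open>By the previous lemma all bases of the quotient have \<open>dim U - dim W\<close> elements, so the definite
  description in \<^const>\<open>quot_dim\<close> denotes this number.\<close>

lemma quot_dim_eq:
  assumes "col.subspace U" "col.subspace W" "W \<subseteq> U" "fin_dim U"
  shows "col.dim U = col.dim W + quot_dim U W"
proof -
  have fW: "fin_dim W" using assms fin_dim_subset by blast
  obtain B where B: "basis_modulo U W B" using basis_modulo_exists[OF assms(2-4)] by blast
  have "quot_dim U W = card B" unfolding quot_dim_def
  proof (rule the_equality)
    show "\<exists>B'. basis_modulo U W B' \<and> card B' = card B" using B by blast
  next
    fix n assume "\<exists>B'. basis_modulo U W B' \<and> card B' = n"
    then show "n = card B"
      using dim_add_card_basis_modulo[OF assms(1-3) fW] B by (metis add_left_cancel)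
  qed
  then show ?thesis using dim_add_card_basis_modulo[OF assms(1-3) fW B] by simp
qed

text \<open>The map \<open>f\<close> induces an isomorphism of \<open>I / (I \<inter> f\<inverse>(W))\<close> onto \<open>(W + f(I)) / W\<close>.\<close>

lemma basis_modulo_image:
  assumes f: "Vector_Spaces.linear col_scale col_scale f"
    and I: "col.subspace I" and W: "col.subspace W"
    and B: "basis_modulo I {v \<in> I. f v \<in> W} B"
  shows "basis_modulo {w + v |w v. w \<in> W \<and> v \<in> f ` I} W (f ` B)" and "inj_on f B"
proof -
  interpret f: Vector_Spaces.linear col_scale col_scale f by (fact f)
  have finB: "finite B" and BI: "B \<subseteq> I" using B by (auto simp: basis_modulo_def)
  have sumI: "(\<Sum>b\<in>B. col_scale (c b) b) \<in> I" for c
    using BI I by (intro col.subspace_sum) (auto intro: col.subspace_scale)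
  have indB: "c b = 0" if "f (\<Sum>b\<in>B. col_scale (c b) b) \<in> W" "b \<in> B" for c b
    using B that sumI unfolding basis_modulo_def by blast
  show inj: "inj_on f B"
  proof (rule inj_onI, rule ccontr)
    fix x y assume xy: "x \<in> B" "y \<in> B" "f x = f y" "x \<noteq> y"
    \<comment> \<open>The difference \<open>x - y\<close> is a combination of \<open>B\<close> that is sent to zero.\<close>
    define c where "c b = (if b = x then 1 else if b = y then - 1 else 0 :: 'a)" for b
    have "f (\<Sum>b\<in>B. col_scale (c b) b) = (\<Sum>b\<in>B. col_scale (c b) (f b))"
      by (simp add: f.sum f.scale)
    also have "\<dots> = (\<Sum>b\<in>B. (if b = x then f x else 0) - (if b = y then f y else 0))"
      using xy by (intro sum.cong) (auto simp: c_def)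
    also have "\<dots> = f x - f y" using xy finB by (simp add: sum_subtractf)
    finally have "f (\<Sum>b\<in>B. col_scale (c b) b) \<in> W" using xy W by (simp add: col.subspace_0)
    then show False using indB[of c x] xy by (simp add: c_def)
  qed
  have re: "(\<Sum>b\<in>f ` B. col_scale (c b) b) = f (\<Sum>b\<in>B. col_scale (c (f b)) b)" for c
    using inj by (simp add: sum.reindex f.sum f.scale)
  show "basis_modulo {w + v |w v. w \<in> W \<and> v \<in> f ` I} W (f ` B)" unfolding basis_modulo_def
  proof (intro conjI ballI allI impI)
    show "finite (f ` B)" using finB by simp
    show "f ` B \<subseteq> {w + v |w v. w \<in> W \<and> v \<in> f ` I}"
      using BI col.subspace_0[OF W] by force
  next
    fix u assume "u \<in> {w + v |w v. w \<in> W \<and> v \<in> f ` I}"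
    then obtain w v where u: "u = w + f v" "w \<in> W" "v \<in> I" by blast
    then obtain c where c: "v - (\<Sum>b\<in>B. col_scale (c b) b) \<in> {v \<in> I. f v \<in> W}"
      using B unfolding basis_modulo_def by blast
    have "(\<Sum>b\<in>B. col_scale (c (inv_into B f (f b))) b) = (\<Sum>b\<in>B. col_scale (c b) b)"
      using inj by (intro sum.cong) auto
    then have eq: "u - (\<Sum>b\<in>f ` B. col_scale (c (inv_into B f b)) b)
        = w + f (v - (\<Sum>b\<in>B. col_scale (c b) b))"
      unfolding re by (simp add: u f.diff)
    have "w + f (v - (\<Sum>b\<in>B. col_scale (c b) b)) \<in> W"
      using c u W by (intro col.subspace_add) auto
    then show "\<exists>c. u - (\<Sum>b\<in>f ` B. col_scale (c b) b) \<in> W"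
      unfolding eq[symmetric] by (intro exI[of _ "\<lambda>b. c (inv_into B f b)"])
  next
    fix c b assume "(\<Sum>b\<in>f ` B. col_scale (c b) b) \<in> W" "b \<in> f ` B"
    then show "c b = 0" unfolding re using indB[of "\<lambda>b. c (f b)"] by auto
  qed
qed

text \<open>Both quotients of the previous lemma have the same dimension. This is the form in which the formula
  for \<open>\<eta>\<close> of a product arises; rank-nullity is the case \<open>W = 0\<close>.\<close>

lemma dim_sum_image:
  assumes f: "Vector_Spaces.linear col_scale col_scale f"
    and I: "col.subspace I" and W: "col.subspace W" and fI: "fin_dim I" and fW: "fin_dim W"
  shows "col.dim {w + v |w v. w \<in> W \<and> v \<in> f ` I} + col.dim {v \<in> I. f v \<in> W}
    = col.dim W + col.dim I"
proof -
  let ?K = "{v \<in> I. f v \<in> W}"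
  have K: "col.subspace ?K" "?K \<subseteq> I" "fin_dim ?K"
    using subspace_preimage[OF f I W] fI fin_dim_subset[OF fI] by auto
  obtain B where B: "basis_modulo I ?K B" using basis_modulo_exists[OF K(1,2) fI] by blast
  note im = basis_modulo_image[OF f I W B]
  have sub: "W \<subseteq> {w + v |w v. w \<in> W \<and> v \<in> f ` I}"
    using col.subspace_0[OF subspace_image[OF f I]] by force
  have "col.dim {w + v |w v. w \<in> W \<and> v \<in> f ` I} = col.dim W + card (f ` B)"
    by (rule dim_add_card_basis_modulo[OF col.subspace_sums[OF W subspace_image[OF f I]] W sub fW im(1)])
  moreover have "col.dim I = col.dim ?K + card B"
    by (rule dim_add_card_basis_modulo[OF I K B])
  ultimately show ?thesis using im(2) by (simp add: card_image)
qed

lemma fin_dim_0: "fin_dim {0}" by (simp add: finite_imp_fin_dim)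

lemma rank_nullity:
  assumes f: "Vector_Spaces.linear col_scale col_scale f"
    and I: "col.subspace I" and fI: "fin_dim I"
  shows "col.dim (f ` I) + col.dim {v \<in> I. f v = 0} = col.dim I"
proof -
  have "{w + v |w v. w \<in> {0} \<and> v \<in> f ` I} = f ` I" by auto
  moreover have "col.dim {0 :: 'a col} = 0"
    using col.dim_le_card[of "{0}" "{}"] by (simp add: col.span_empty)
  ultimately show ?thesis
    using dim_sum_image[OF f I col.subspace_single_0 fI fin_dim_0] by simp
qed

lemma dim_image_inj:
  assumes f: "Vector_Spaces.linear col_scale col_scale f"
    and I: "col.subspace I" and fI: "fin_dim I" and inj: "\<And>v. v \<in> I \<Longrightarrow> f v = 0 \<Longrightarrow> v = 0"
  shows "col.dim (f ` I) = col.dim I"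
proof -
  have "{v \<in> I. f v = 0} \<subseteq> col.span {}" using inj by auto
  then have "col.dim {v \<in> I. f v = 0} \<le> card ({} :: 'a col set)"
    by (rule col.dim_le_card) simp
  then show ?thesis using rank_nullity[OF f I fI] by simp
qed

lemma dim_mono:
  assumes "col.subspace U" "col.subspace W" "W \<subseteq> U" "fin_dim U"
  shows "col.dim W \<le> col.dim U"
  using quot_dim_eq[OF assms] by simp

text \<open>Invertibility of a finitary matrix on an invariant infinite-dimensional space is reduced to this:
  the quotient \<open>I / f(I)\<close> has dimension zero.\<close>

lemma endomorphism_surj:
  assumes f: "Vector_Spaces.linear col_scale col_scale f"
    and I: "col.subspace I" and fI: "fin_dim I" and inj: "\<And>v. v \<in> I \<Longrightarrow> f v = 0 \<Longrightarrow> v = 0"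
    and into: "f ` I \<subseteq> I"
  shows "f ` I = I"
proof -
  obtain B where B: "basis_modulo I (f ` I) B"
    using basis_modulo_exists[OF subspace_image[OF f I] into fI] by blast
  have "col.dim I = col.dim (f ` I) + card B"
    by (rule dim_add_card_basis_modulo[OF I subspace_image[OF f I] into fin_dim_image[OF f fI] B])
  then have "card B = 0" using dim_image_inj[OF f I fI inj] by simp
  then have "B = {}" using B by (simp add: basis_modulo_def)
  then have "I \<subseteq> f ` I" using B by (auto simp: basis_modulo_def)
  then show ?thesis using into by blast
qed

section \<open>The action of matrices on columns\<close>

text \<open>For such a matrix every entry of \<^term>\<open>act A v\<close> is a finite sum, whatever the support of \<open>v\<close>.
  Hence \<open>act A\<close> is linear on all columns and matrix products act as compositions, and no support
  has to be tracked in algebraic manipulations.\<close>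

definition row_finite :: "'k::field imat \<Rightarrow> bool" where
  "row_finite A \<longleftrightarrow> (\<forall>i. finite {j. A i j \<noteq> 0})"

lemma act_eq_sum:
  assumes "finite S" "\<And>j. A i j * v j \<noteq> 0 \<Longrightarrow> j \<in> S"
  shows "act A v i = (\<Sum>j\<in>S. A i j * v j)"
  unfolding act_def using assms by (intro Sum_any.expand_superset) auto

lemma act_eq_row_sum: "row_finite A \<Longrightarrow> act A v i = (\<Sum>j | A i j \<noteq> 0. A i j * v j)"
  by (rule act_eq_sum) (auto simp: row_finite_def)

lemma linear_act:
  assumes "row_finite A"
  shows "Vector_Spaces.linear col_scale col_scale (act A)"
  unfolding Vector_Spaces.linear_iff using assms
  by (auto simp: fun_eq_iff act_eq_row_sum col_scale_def sum.distrib sum_distrib_left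
      algebra_simps col.vector_space_axioms)

text \<open>The columns of \<open>A B\<close> are the images of the columns of \<open>B\<close> under \<open>A\<close>; this reduces associativity
  and the unit laws to facts about the action.\<close>

lemma imat_mult_eq_act: "imat_mult A B i j = act A (\<lambda>m. B m j) i"
  by (simp add: imat_mult_def act_def)

lemma act_imat_mult:
  assumes A: "row_finite A" and B: "row_finite B"
  shows "act (imat_mult A B) v = act A (act B v)"
proof
  fix i
  define S where "S = {m. A i m \<noteq> 0}"
  \<comment> \<open>The columns that can contribute to row \<open>i\<close> of the product, so that both sums may be exchanged.\<close>
  define T where "T = (\<Union>m\<in>S. {j. B m j \<noteq> 0})"
  have fin: "finite S" "finite T" using A B by (auto simp: S_def T_def row_finite_def)
  have ab: "imat_mult A B i j = (\<Sum>m\<in>S. A i m * B m j)" for j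
    using A by (simp add: imat_mult_eq_act act_eq_row_sum S_def)
  have "act (imat_mult A B) v i = (\<Sum>j\<in>T. imat_mult A B i j * v j)"
  proof (rule act_eq_sum[OF fin(2)])
    fix j assume "imat_mult A B i j * v j \<noteq> 0"
    then have "(\<Sum>m\<in>S. A i m * B m j) \<noteq> 0" by (simp add: ab)
    then obtain m where "m \<in> S" "A i m * B m j \<noteq> 0" by (rule sum.not_neutral_contains_not_neutral)
    then show "j \<in> T" by (auto simp: T_def)
  qed
  also have "\<dots> = (\<Sum>m\<in>S. A i m * (\<Sum>j\<in>T. B m j * v j))"
    unfolding ab sum_distrib_right sum_distrib_left by (subst sum.swap) (simp add: mult.assoc)
  also have "\<dots> = (\<Sum>m\<in>S. A i m * act B v m)"
    using fin by (intro sum.cong refl) (subst act_eq_sum[of T], auto simp: T_def)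
  also have "\<dots> = act A (act B v) i" using A by (simp add: act_eq_row_sum S_def)
  finally show "act (imat_mult A B) v i = act A (act B v) i" .
qed

lemma row_finite_imat_mult:
  assumes A: "row_finite A" and B: "row_finite B"
  shows "row_finite (imat_mult A B)"
  unfolding row_finite_def
proof
  fix i
  have "{j. imat_mult A B i j \<noteq> 0} \<subseteq> (\<Union>m\<in>{m. A i m \<noteq> 0}. {j. B m j \<noteq> 0})"
  proof
    fix j assume "j \<in> {j. imat_mult A B i j \<noteq> 0}"
    then have "(\<Sum>m | A i m \<noteq> 0. A i m * B m j) \<noteq> 0"
      using A by (simp add: imat_mult_eq_act act_eq_row_sum)
    then obtain m where "A i m \<noteq> 0" "A i m * B m j \<noteq> 0"
      by (metis (mono_tags, lifting) mem_Collect_eq sum.not_neutral_contains_not_neutral)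
    then show "j \<in> (\<Union>m\<in>{m. A i m \<noteq> 0}. {j. B m j \<noteq> 0})" by auto
  qed
  then show "finite {j. imat_mult A B i j \<noteq> 0}"
    using A B by (auto simp: row_finite_def elim: finite_subset)
qed

lemma imat_mult_assoc:
  assumes "row_finite A" "row_finite B"
  shows "imat_mult (imat_mult A B) C = imat_mult A (imat_mult B C)"
proof (intro ext)
  fix i j
  have "imat_mult (imat_mult A B) C i j = act A (act B (\<lambda>m. C m j)) i"
    by (simp only: imat_mult_eq_act[of "imat_mult A B"] act_imat_mult[OF assms])
  also have "act B (\<lambda>m. C m j) = (\<lambda>m. imat_mult B C m j)"
    by (simp add: imat_mult_eq_act)
  also have "act A \<dots> i = imat_mult A (imat_mult B C) i j"
    by (simp only: imat_mult_eq_act[of A])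
  finally show "imat_mult (imat_mult A B) C i j = imat_mult A (imat_mult B C) i j" .
qed

lemma act_identity_row: "(\<And>j. A i j = imat_one i j) \<Longrightarrow> act A v i = v i"
  by (subst act_eq_sum[of "{i}"]) (auto simp: imat_one_def split: if_splits)

lemma act_identity_columns: "(\<And>i j. v j \<noteq> 0 \<Longrightarrow> A i j = imat_one i j) \<Longrightarrow> act A v = v"
proof
  fix i assume *: "\<And>i j. v j \<noteq> 0 \<Longrightarrow> A i j = imat_one i j"
  have "A i j * v j = imat_one i j * v j" for j
    by (cases "v j = 0") (simp_all add: *)
  then have "act A v i = act imat_one v i" unfolding act_def by (rule Sum_any.cong)
  also have "\<dots> = v i" by (rule act_identity_row) simp
  finally show "act A v i = v i" .
qed

lemma act_unit_column: "act A (\<lambda>m. imat_one m j) i = A i j"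
  by (subst act_eq_sum[of "{j}"]) (auto simp: imat_one_def split: if_splits)

lemma one_outsideD:
  "one_outside s t A \<Longrightarrow> \<not> (s < i \<and> i \<le> t \<and> s < j \<and> j \<le> t) \<Longrightarrow> A i j = imat_one i j"
  unfolding one_outside_def by blast

lemma one_outside_mono:
  assumes "one_outside s t A" "s' \<le> s" "t \<le> t'"
  shows "one_outside s' t' A"
  unfolding one_outside_def
proof (intro allI impI)
  fix i j assume "\<not> (s' < i \<and> i \<le> t' \<and> s' < j \<and> j \<le> t')"
  then have "\<not> (s < i \<and> i \<le> t \<and> s < j \<and> j \<le> t)" using assms(2,3) by linarith
  then show "A i j = imat_one i j" by (rule one_outsideD[OF assms(1)])
qed

lemma one_outside_imat_mult:
  assumes "one_outside s t A" "one_outside s t B"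
  shows "one_outside s t (imat_mult A B)"
  unfolding one_outside_def
proof (intro allI impI)
  fix i j assume *: "\<not> (s < i \<and> i \<le> t \<and> s < j \<and> j \<le> t)"
  show "imat_mult A B i j = imat_one i j"
  proof (cases "s < i \<and> i \<le> t")
    case False
    then have "imat_mult A B i j = B i j"
      using assms(1) unfolding imat_mult_eq_act by (intro act_identity_row) (auto simp: one_outside_def)
    then show ?thesis using assms(2) False by (auto simp: one_outside_def)
  next
    case True
    then have "(\<lambda>m. B m j) = (\<lambda>m. imat_one m j)"
      using assms(2) * by (auto simp: one_outside_def)
    then have "imat_mult A B i j = A i j" unfolding imat_mult_eq_act by (simp add: act_unit_column)
    then show ?thesis using assms(1) * by (auto simp: one_outside_def)
  qed
qed

text \<open>Finitely many deviations from the identity fit into one square. All finiteness arguments below are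
  made inside such a square.\<close>

lemma finitary_iff_one_outside: "A \<in> carrier finitary_monoid \<longleftrightarrow> (\<exists>s t. one_outside s t A)"
proof
  assume "A \<in> carrier finitary_monoid"
  then have fin: "finite {(i, j). A i j \<noteq> imat_one i j}" (is "finite ?D")
    by (simp add: finitary_monoid_def)
  define E where "E = fst ` ?D \<union> snd ` ?D"
  have finE: "finite E" using fin by (simp add: E_def)
  \<comment> \<open>The range of a square is open on the left, hence the subtraction of 1; 0 is inserted for \<open>E = {}\<close>.\<close>
  have "one_outside (Min (insert 0 E) - 1) (Max (insert 0 E)) A" unfolding one_outside_def
  proof (intro allI impI, rule ccontr)
    fix i j assume *: "\<not> (Min (insert 0 E) - 1 < i \<and> i \<le> Max (insert 0 E) \<and>
        Min (insert 0 E) - 1 < j \<and> j \<le> Max (insert 0 E))" and "A i j \<noteq> imat_one i j"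
    then have "i \<in> E" "j \<in> E" by (force simp: E_def)+
    then have "Min (insert 0 E) \<le> i" "i \<le> Max (insert 0 E)" "Min (insert 0 E) \<le> j" "j \<le> Max (insert 0 E)"
      using finE by (auto intro!: Min_le Max_ge)
    then show False using * by linarith
  qed
  then show "\<exists>s t. one_outside s t A" by blast
next
  assume "\<exists>s t. one_outside s t A"
  then obtain s t where st: "one_outside s t A" by blast
  have "{(i, j). A i j \<noteq> imat_one i j} \<subseteq> {s<..t} \<times> {s<..t}"
  proof clarify
    fix i j assume n: "A i j \<noteq> imat_one i j"
    have "s < i \<and> i \<le> t \<and> s < j \<and> j \<le> t"
      using n one_outsideD[OF st, of i j] by argo
    then show "i \<in> {s<..t} \<and> j \<in> {s<..t}" by simp
  qed
  then have "finite {(i, j). A i j \<noteq> imat_one i j}" by (rule finite_subset) simp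
  then show "A \<in> carrier finitary_monoid" by (simp add: finitary_monoid_def)
qed

lemma row_finite_one_outside:
  assumes "one_outside s t A" shows "row_finite A"
  unfolding row_finite_def
proof
  fix i
  have "{j. A i j \<noteq> 0} \<subseteq> insert i {s<..t}"
  proof
    fix j assume j: "j \<in> {j. A i j \<noteq> 0}"
    show "j \<in> insert i {s<..t}"
    proof (rule ccontr)
      assume n: "j \<notin> insert i {s<..t}"
      then have "A i j = imat_one i j" by (intro one_outsideD[OF assms]) auto
      then show False using j n by (simp add: imat_one_def)
    qed
  qed
  then show "finite {j. A i j \<noteq> 0}" by (rule finite_subset) simp
qed

lemma row_finite_finitary: "A \<in> carrier finitary_monoid \<Longrightarrow> row_finite A"
  using finitary_iff_one_outside row_finite_one_outside by blast

lemma monoid_finitary: "monoid finitary_monoid"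
proof (rule monoidI)
  fix A B :: "'a imat" assume "A \<in> carrier finitary_monoid" "B \<in> carrier finitary_monoid"
  then obtain s t s' t' where "one_outside s t A" "one_outside s' t' B"
    by (auto simp: finitary_iff_one_outside)
  then have "one_outside (min s s') (max t t') A" "one_outside (min s s') (max t t') B"
    by (auto elim: one_outside_mono)
  then have "one_outside (min s s') (max t t') (imat_mult A B)" by (rule one_outside_imat_mult)
  then show "A \<otimes>\<^bsub>finitary_monoid\<^esub> B \<in> carrier finitary_monoid"
    unfolding finitary_iff_one_outside by (auto simp: finitary_monoid_def)
next
  show "\<one>\<^bsub>finitary_monoid\<^esub> \<in> carrier (finitary_monoid :: 'a imat monoid)"
    by (simp add: finitary_monoid_def)
next
  fix A B C :: "'a imat"
  assume "A \<in> carrier finitary_monoid" "B \<in> carrier finitary_monoid" "C \<in> carrier finitary_monoid"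
  then show "A \<otimes>\<^bsub>finitary_monoid\<^esub> B \<otimes>\<^bsub>finitary_monoid\<^esub> C
      = A \<otimes>\<^bsub>finitary_monoid\<^esub> (B \<otimes>\<^bsub>finitary_monoid\<^esub> C)"
    using row_finite_finitary[of A] row_finite_finitary[of B] imat_mult_assoc[of A B C]
    by (simp add: finitary_monoid_def)
next
  fix A :: "'a imat"
  have "imat_mult imat_one A = A"
    by (intro ext) (simp add: imat_mult_eq_act act_identity_row)
  then show "\<one>\<^bsub>finitary_monoid\<^esub> \<otimes>\<^bsub>finitary_monoid\<^esub> A = A" by (simp add: finitary_monoid_def)
  have "imat_mult A imat_one = A"
    by (intro ext) (simp add: imat_mult_eq_act act_unit_column)
  then show "A \<otimes>\<^bsub>finitary_monoid\<^esub> \<one>\<^bsub>finitary_monoid\<^esub> = A" by (simp add: finitary_monoid_def)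
qed

lemma group_GL: "group (GL :: 'k::field imat monoid)"
  unfolding GL_def by (rule monoid.units_group[OF monoid_finitary])

lemma GL_one_outside:
  assumes "A \<in> carrier GL" obtains s t where "one_outside s t A"
  using assms finitary_iff_one_outside[of A] unfolding GL_def units_of_def Units_def by auto

lemma GL_row_finite: "A \<in> carrier GL \<Longrightarrow> row_finite A"
  using GL_one_outside row_finite_one_outside by metis

lemma GL_mult: "A \<otimes>\<^bsub>GL\<^esub> B = imat_mult A B"
  by (simp add: GL_def units_of_def finitary_monoid_def)

lemma GL_one: "\<one>\<^bsub>GL\<^esub> = imat_one"
  by (simp add: GL_def units_of_def finitary_monoid_def)

lemma act_inv_GL:
  assumes "A \<in> carrier GL"
  shows "act (inv\<^bsub>GL\<^esub> A) (act A v) = v" and "act A (act (inv\<^bsub>GL\<^esub> A) v) = v"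
proof -
  interpret group GL by (rule group_GL)
  have one: "act imat_one v = v" for v :: "'a col" by (rule ext) (simp add: act_identity_row)
  note rf = GL_row_finite[OF assms] GL_row_finite[OF inv_closed[OF assms]]
  show "act (inv\<^bsub>GL\<^esub> A) (act A v) = v"
    using act_imat_mult[OF rf(2,1), of v] l_inv[OF assms] one by (simp add: GL_mult GL_one)
  show "act A (act (inv\<^bsub>GL\<^esub> A) v) = v"
    using act_imat_mult[OF rf, of v] r_inv[OF assms] one by (simp add: GL_mult GL_one)
qed

section \<open>Columns with bounded support, and the rank \<open>\<eta>\<close>\<close>

text \<open>With \<open>\<alpha> = (a, b)\<close> the spaces \<open>lower a\<close> and \<open>mids a b\<close> are the first two summands of the
  decomposition for \<open>\<alpha>\<close>, and \<open>lower b\<close> is their sum; \<open>above b\<close> is the projection onto the third one,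
  extended to all columns. Taking single integers instead of pairs allows the same spaces to be
  truncated at other places, such as at the border \<open>s\<close> of a square.\<close>

definition lower :: "int \<Rightarrow> 'k::field col set" where
  "lower c = {v. finite {j. v j \<noteq> 0} \<and> (\<forall>j. c < j \<longrightarrow> v j = 0)}"

definition mids :: "int \<Rightarrow> int \<Rightarrow> 'k::field col set" where
  "mids a b = {v. \<forall>j. \<not> (a < j \<and> j \<le> b) \<longrightarrow> v j = 0}"

definition above :: "int \<Rightarrow> 'k::field col \<Rightarrow> 'k col" where
  "above c v = (\<lambda>j. if c < j then v j else 0)"

lemma col_minus_eq_lower: "col_minus \<alpha> = lower (fst \<alpha>)"
  unfolding col_minus_def lower_def by (auto simp: not_le[symmetric])

lemma finite_support_mids: "v \<in> mids a b \<Longrightarrow> finite {j. v j \<noteq> 0}"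
  by (rule finite_subset[of _ "{a<..b}"]) (auto simp: mids_def)

lemma finite_support_lower: "v \<in> lower a \<Longrightarrow> finite {j. v j \<noteq> 0}"
  by (simp add: lower_def)

lemma col_mid_eq_mids: "col_mid \<alpha> = mids (fst \<alpha>) (snd \<alpha>)"
  using finite_support_mids unfolding col_mid_def by (auto simp: mids_def)

lemma finite_support_add:
  "finite {j. v j \<noteq> 0} \<Longrightarrow> finite {j. w j \<noteq> 0} \<Longrightarrow> finite {j. (v + w) j \<noteq> (0 :: 'k::field)}"
  by (rule finite_subset[of _ "{j. v j \<noteq> 0} \<union> {j. w j \<noteq> 0}"]) auto

lemma subspace_lower: "col.subspace (lower c)"
  unfolding col.subspace_def
proof (intro conjI ballI allI)
  fix v w :: "'a col" assume "v \<in> lower c" "w \<in> lower c"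
  then show "v + w \<in> lower c" using finite_support_add[of v w] by (simp add: lower_def)
next
  fix k and v :: "'a col" assume "v \<in> lower c"
  then show "col_scale k v \<in> lower c"
    by (auto simp: lower_def col_scale_def elim: finite_subset[rotated])
qed (simp add: lower_def)

lemma subspace_mids: "col.subspace (mids a b)"
  unfolding col.subspace_def mids_def by (simp add: col_scale_def)

lemma lower_mono: "a \<le> b \<Longrightarrow> lower a \<subseteq> lower b"
  unfolding lower_def by auto

lemma mids_subset_lower: "mids a b \<subseteq> lower b"
  using finite_support_mids unfolding lower_def by (auto simp: mids_def)

lemma lower_add: "v \<in> lower c \<Longrightarrow> w \<in> lower c \<Longrightarrow> v + w \<in> lower c"
  using subspace_lower by (rule col.subspace_add)

lemma lower_diff: "v \<in> lower c \<Longrightarrow> w \<in> lower c \<Longrightarrow> v - w \<in> lower c"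
  using subspace_lower by (rule col.subspace_diff)

lemma lower_0: "0 \<in> lower c" by (simp add: lower_def)

lemma mids_0: "0 \<in> mids a b" by (simp add: mids_def)

lemma lower_split:
  assumes "v \<in> lower b"
  obtains x u where "x \<in> lower a" "u \<in> mids a b" "v = x + u"
proof
  show "v - above a v \<in> lower a" "above a v \<in> mids a b"
    using assms by (auto simp: lower_def mids_def above_def elim: finite_subset[rotated])
  show "v = (v - above a v) + above a v" by simp
qed

lemma linear_above: "Vector_Spaces.linear col_scale col_scale (above c)"
  unfolding Vector_Spaces.linear_iff
  by (auto simp: above_def fun_eq_iff col_scale_def col.vector_space_axioms)

lemma above_add: "above c (v + w) = above c v + above c w"
  by (auto simp: above_def fun_eq_iff)

lemma above_lower: "v \<in> lower c \<Longrightarrow> above c v = 0"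
  by (auto simp: above_def lower_def fun_eq_iff)

lemma above_eq_0_imp_lower: "above c v = 0 \<Longrightarrow> finite {j. v j \<noteq> 0} \<Longrightarrow> v \<in> lower c"
  by (auto simp: above_def lower_def fun_eq_iff split: if_splits)

lemma lower_add_mids:
  assumes "x \<in> lower a" "u \<in> mids a b" "a \<le> c" "b \<le> c"
  shows "x + u \<in> lower c"
proof (rule lower_add)
  show "x \<in> lower c" using assms(1) lower_mono[OF assms(3)] by blast
  show "u \<in> lower c" using assms(2) mids_subset_lower lower_mono[OF assms(4)] by blast
qed

lemma lower_imp_mids: "v \<in> lower b \<Longrightarrow> (\<And>i. i \<le> a \<Longrightarrow> v i = 0) \<Longrightarrow> v \<in> mids a b"
  by (auto simp: lower_def mids_def not_le not_less)

lemma above_comp_above: "a \<le> b \<Longrightarrow> above b (above a v) = above b v"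
  by (auto simp: above_def fun_eq_iff)

lemma above_mids: "u \<in> mids a b \<Longrightarrow> above a u = u"
  by (auto simp: above_def mids_def fun_eq_iff)

lemma sum_col_apply: "(\<Sum>j\<in>S. (f j :: 'k::field col)) i = (\<Sum>j\<in>S. f j i)"
  by (induction S rule: infinite_finite_induct) auto

text \<open>The columns \<open>\<lambda>m. imat_one m j\<close> are the unit vectors.\<close>

lemma mids_expansion:
  assumes "v \<in> mids a b"
  shows "v = (\<Sum>j\<in>{a<..b}. col_scale (v j) (\<lambda>m. imat_one m j))"
proof
  fix i
  have "(\<Sum>j\<in>{a<..b}. v j * imat_one i j) = (\<Sum>j\<in>{a<..b}. if i = j then v j else 0)"
    by (rule sum.cong) (auto simp: imat_one_def)
  also have "\<dots> = v i" using assms by (auto simp: mids_def)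
  finally show "v i = (\<Sum>j\<in>{a<..b}. col_scale (v j) (\<lambda>m. imat_one m j)) i"
    by (simp add: sum_col_apply col_scale_def)
qed

lemma inj_unit_columns: "inj (\<lambda>j m. imat_one m j :: 'k::field)"
proof (rule injI)
  fix i j assume "(\<lambda>m. imat_one m i :: 'k) = (\<lambda>m. imat_one m j)"
  from fun_cong[OF this, of i] show "i = j" by (auto simp: imat_one_def split: if_splits)
qed

lemma dim_mids: "col.dim (mids a b :: 'k::field col set) = nat (b - a)"
  and fin_dim_mids: "fin_dim (mids a b :: 'k::field col set)"
proof -
  define e where "e j = (\<lambda>m. imat_one m j :: 'k)" for j
  define B where "B = e ` {a<..b}"
  have inj: "inj_on e {a<..b}" unfolding e_def by (rule inj_on_subset[OF inj_unit_columns subset_UNIV])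
  have fin: "finite B" by (simp add: B_def)
  have BM: "B \<subseteq> mids a b" by (auto simp: B_def e_def mids_def imat_one_def)
  have sp: "mids a b \<subseteq> col.span B"
  proof
    fix v :: "'k col" assume "v \<in> mids a b"
    then have "v = (\<Sum>j\<in>{a<..b}. col_scale (v j) (e j))" unfolding e_def by (rule mids_expansion)
    also have "\<dots> \<in> col.span B" by (intro col.span_sum col.span_scale col.span_base) (simp add: B_def)
    finally show "v \<in> col.span B" .
  qed
  have ind: "col.independent B"
  proof (subst col.dependent_finite[OF fin], clarify)
    fix c v assume v: "v \<in> B" "c v \<noteq> 0" and z: "(\<Sum>v\<in>B. col_scale (c v) v) = 0"
    then obtain i where i: "i \<in> {a<..b}" "v = e i" by (auto simp: B_def)
    have "(\<Sum>v\<in>B. col_scale (c v) v) i = (\<Sum>j\<in>{a<..b}. if i = j then c (e j) else 0)"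
      unfolding B_def sum.reindex[OF inj] sum_col_apply
      by (intro sum.cong) (auto simp: e_def col_scale_def imat_one_def)
    also have "\<dots> = c v" using i by simp
    finally show False using v z by simp
  qed
  show "col.dim (mids a b :: 'k col set) = nat (b - a)"
    using col.basis_card_eq_dim[OF BM sp ind] by (simp add: B_def card_image[OF inj])
  show "fin_dim (mids a b :: 'k col set)" using fin sp unfolding fin_dim_def by blast
qed

lemma act_outside: "one_outside s t A \<Longrightarrow> \<not> (s < i \<and> i \<le> t) \<Longrightarrow> act A v i = v i"
  by (rule act_identity_row) (auto intro: one_outsideD)

lemma act_supported_outside:
  "one_outside s t A \<Longrightarrow> (\<And>j. s < j \<Longrightarrow> j \<le> t \<Longrightarrow> v j = 0) \<Longrightarrow> act A v = v"
  by (rule act_identity_columns) (auto intro: one_outsideD)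

lemma act_lower_fixed: "one_outside s t A \<Longrightarrow> v \<in> lower s \<Longrightarrow> act A v = v"
  by (rule act_supported_outside) (auto simp: lower_def)

lemma finite_support_act:
  assumes "one_outside s t A" "finite {j. v j \<noteq> 0}"
  shows "finite {j. act A v j \<noteq> 0}"
proof (rule finite_subset)
  show "{j. act A v j \<noteq> 0} \<subseteq> {j. v j \<noteq> 0} \<union> {s<..t}"
    using act_outside[OF assms(1)] by force
qed (simp add: assms(2))

lemma act_add: "row_finite A \<Longrightarrow> act A (v + w) = act A v + act A w"
  using linear_act Vector_Spaces.linear_iff by blast

lemma act_diff: "row_finite A \<Longrightarrow> act A (v - w) = act A v - act A w"
  by (metis act_add add_diff_cancel_right' diff_add_cancel)

lemma linear_above_act:
  "row_finite A \<Longrightarrow> Vector_Spaces.linear col_scale col_scale (\<lambda>v. above c (act A v))"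
  using Vector_Spaces.linear_compose[OF linear_act linear_above] by (simp add: o_def)

text \<open>The block \<open>a\<^sub>3\<^sub>1\<close> is the matrix of the map \<open>above \<alpha>\<^sub>+ \<circ> A\<close> on \<open>lower \<beta>\<^sub>-\<close>, so its columns span the
  image of this map. The identity rows outside the square keep the image finite-dimensional although
  the source is not.\<close>

lemma eta_mat_eq_dim:
  assumes A: "one_outside s t A"
  shows "eta_mat \<alpha> \<beta> A = col.dim ((\<lambda>v. above (snd \<alpha>) (act A v)) ` lower (fst \<beta>))"
    (is "_ = col.dim ?E")
    and "fin_dim ((\<lambda>v. above (snd \<alpha>) (act A v)) ` lower (fst \<beta>))"
proof -
  have rf: "row_finite A" using A by (rule row_finite_one_outside)
  let ?R = "range (\<lambda>j i. block31 \<alpha> \<beta> A i j)"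
  have sub: "col.subspace ?E"
    by (rule subspace_image[OF linear_above_act[OF rf] subspace_lower])
  have RE: "?R \<subseteq> ?E"
  proof clarify
    fix j
    show "(\<lambda>i. block31 \<alpha> \<beta> A i j) \<in> ?E"
    proof (cases "j \<le> fst \<beta>")
      case True
      have "{m. imat_one m j \<noteq> (0 :: 'a)} = {j}" by (auto simp: imat_one_def)
      then have "(\<lambda>m. imat_one m j :: 'a) \<in> lower (fst \<beta>)" using True
        by (auto simp: lower_def imat_one_def)
      moreover have "(\<lambda>i. block31 \<alpha> \<beta> A i j) = above (snd \<alpha>) (act A (\<lambda>m. imat_one m j))"
        using True by (auto simp: block31_def above_def act_unit_column fun_eq_iff)
      ultimately show ?thesis by blast
    next
      case False
      then have "(\<lambda>i. block31 \<alpha> \<beta> A i j) = 0" by (auto simp: block31_def)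
      then show ?thesis using col.subspace_0[OF sub] by simp
    qed
  qed
  have ER: "?E \<subseteq> col.span ?R"
  proof clarify
    fix y :: "'a col" assume y: "y \<in> lower (fst \<beta>)"
    let ?S = "{j. y j \<noteq> 0}"
    have "above (snd \<alpha>) (act A y) = (\<Sum>j\<in>?S. col_scale (y j) (\<lambda>i. block31 \<alpha> \<beta> A i j))"
    proof
      fix i
      have "act A y i = (\<Sum>j\<in>?S. A i j * y j)"
        using y by (intro act_eq_sum) (auto simp: lower_def)
      moreover have "j \<le> fst \<beta>" if "y j \<noteq> 0" for j
        using y that by (force simp: lower_def)
      ultimately show "above (snd \<alpha>) (act A y) i
          = (\<Sum>j\<in>?S. col_scale (y j) (\<lambda>i. block31 \<alpha> \<beta> A i j)) i"
        by (auto simp: above_def sum_col_apply col_scale_def block31_def mult.commute intro!: sum.cong)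
    qed
    also have "\<dots> \<in> col.span ?R" by (intro col.span_sum col.span_scale col.span_base) simp
    finally show "above (snd \<alpha>) (act A y) \<in> col.span ?R" .
  qed
  have "col.span ?R = ?E" using RE ER sub by (rule col.span_subspace)
  then show "eta_mat \<alpha> \<beta> A = col.dim ?E"
    unfolding eta_mat_def rk_def by (metis col.dim_span)
  have "?E \<subseteq> mids (snd \<alpha>) (max t (fst \<beta>))"
    by (auto simp: mids_def above_def lower_def le_max_iff_disj act_outside[OF A])
  then show "fin_dim ?E" by (rule fin_dim_subset[OF fin_dim_mids])
qed

section \<open>The subgroups \<open>Q\<close>, and invariance on double cosets\<close>

lemma act_lower:
  assumes A: "one_outside s t A" and tri: "\<And>i j. c < i \<Longrightarrow> j \<le> c \<Longrightarrow> A i j = 0" and v: "v \<in> lower c"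
  shows "act A v \<in> lower c"
proof -
  have "act A v i = 0" if "c < i" for i
    using that tri v by (subst act_eq_sum[of "{}"]) (auto simp: lower_def not_le[symmetric])
  then show ?thesis
    using finite_support_act[OF A finite_support_lower[OF v]] by (simp add: lower_def)
qed

lemma unit_column_lower: "j \<le> c \<Longrightarrow> (\<lambda>m. imat_one m j) \<in> lower c"
  and unit_column_mids: "a < j \<Longrightarrow> j \<le> b \<Longrightarrow> (\<lambda>m. imat_one m j) \<in> mids a b"
  by (auto simp: lower_def mids_def imat_one_def)

text \<open>The block form says that \<open>g\<close> preserves the flag \<open>lower \<alpha>\<^sub>- \<subseteq> lower \<alpha>\<^sub>+\<close> and acts as the identity on
  the quotient of its two members. In this form closure under products and inverses is visible.\<close>

lemma Q_iff:
  assumes "\<alpha> \<in> index_pairs"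
  shows "g \<in> Q \<alpha> \<longleftrightarrow> g \<in> carrier GL \<and>
    (\<forall>v\<in>lower (fst \<alpha>). act g v \<in> lower (fst \<alpha>)) \<and>
    (\<forall>v\<in>lower (snd \<alpha>). act g v \<in> lower (snd \<alpha>)) \<and>
    (\<forall>u\<in>mids (fst \<alpha>) (snd \<alpha>). act g u - u \<in> lower (fst \<alpha>))" (is "_ \<longleftrightarrow> ?R")
proof
  assume g: "g \<in> Q \<alpha>"
  then have G: "g \<in> carrier GL" by (simp add: Q_def)
  obtain s t where st: "one_outside s t g" using GL_one_outside[OF G] .
  have "act g u - u \<in> lower (fst \<alpha>)" if u: "u \<in> mids (fst \<alpha>) (snd \<alpha>)" for u
  proof -
    have "act g u i = u i" if i: "fst \<alpha> < i" for i
    proof -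
      have "g i j * u j = imat_one i j * u j" for j
      proof (cases "u j = 0")
        case False
        then have j: "fst \<alpha> < j" "j \<le> snd \<alpha>" using u unfolding mids_def by blast+
        show ?thesis
        proof (cases "i \<le> snd \<alpha>")
          case True then show ?thesis using g i j by (simp add: Q_def)
        next
          case False then show ?thesis using g i j by (auto simp: Q_def imat_one_def)
        qed
      qed simp
      then have "act g u i = act imat_one u i" unfolding act_def by (rule Sum_any.cong)
      also have "\<dots> = u i" by (rule act_identity_row) simp
      finally show ?thesis .
    qed
    moreover have "finite {j. (act g u - u) j \<noteq> 0}"
      by (rule finite_subset[OF _ finite_UnI[OF finite_support_act[OF st] ]])
         (use finite_support_mids[OF u] in auto)
    ultimately show ?thesis by (simp add: lower_def)
  qed
  then show ?R using G g act_lower[OF st] by (auto simp: Q_def)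
next
  assume R: ?R
  then obtain s t where st: "one_outside s t g" using GL_one_outside by blast
  have tri: "g i j = 0" if "c < i" "j \<le> c" "\<forall>v\<in>lower c. act g v \<in> lower c" for c i j
    using that unit_column_lower[of j c] act_unit_column[of g j i] by (force simp: lower_def)
  have "g i j = imat_one i j" if "fst \<alpha> < i" "fst \<alpha> < j" "j \<le> snd \<alpha>" for i j
  proof -
    have "act g (\<lambda>m. imat_one m j) - (\<lambda>m. imat_one m j) \<in> lower (fst \<alpha>)"
      using R that unit_column_mids by blast
    then have "(act g (\<lambda>m. imat_one m j) - (\<lambda>m. imat_one m j)) i = 0"
      using that by (auto simp only: lower_def)
    then show ?thesis by (simp add: act_unit_column)
  qed
  then show "g \<in> Q \<alpha>" using R tri by (auto simp: Q_def)
qed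

text \<open>An injective map may send an infinite-dimensional space properly into itself. Here it cannot: below
  the square \<open>g\<close> is the identity, and the part of \<open>lower c\<close> that remains is finite-dimensional and
  mapped into itself, hence onto itself.\<close>

lemma act_inv_lower:
  assumes G: "g \<in> carrier GL" and tri: "\<And>v. v \<in> lower c \<Longrightarrow> act g v \<in> lower c"
    and v: "v \<in> lower c"
  shows "act (inv\<^bsub>GL\<^esub> g) v \<in> lower c"
proof -
  interpret group "GL :: 'a imat monoid" by (rule group_GL)
  have rf: "row_finite (inv\<^bsub>GL\<^esub> g)" "row_finite g" using G GL_row_finite by auto
  obtain s' t where "one_outside s' t g" using GL_one_outside[OF G] .
  then have st: "one_outside (min s' c) t g" by (rule one_outside_mono) auto
  define s where "s = min s' c"
  have inj: "v = 0" if "act g v = 0" for v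
    using act_inv_GL(1)[OF G, of v] that act_diff[OF rf(1), of 0 0] by simp
  have "act g v \<in> mids s c" if "v \<in> mids s c" for v
  proof -
    have "act g v \<in> lower c" using that mids_subset_lower tri by blast
    moreover have "act g v i = 0" if "i \<le> s" for i
    proof -
      have "act g v i = v i" using that by (intro act_outside[OF st]) (auto simp: s_def min_less_iff_disj)
      then show ?thesis using that \<open>v \<in> mids s c\<close> by (simp add: mids_def)
    qed
    ultimately show ?thesis by (auto simp: mids_def lower_def not_less)
  qed
  then have im: "act g ` mids s c = mids s c"
    using inj by (intro endomorphism_surj linear_act rf subspace_mids fin_dim_mids) auto
  obtain x u where xu: "x \<in> lower s" "u \<in> mids s c" "v = x + u" using lower_split[OF v] .
  obtain y where y: "y \<in> mids s c" "u = act g y" using xu(2) im by blast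
  have "act (inv\<^bsub>GL\<^esub> g) u = y" using y act_inv_GL(1)[OF G] by simp
  moreover have "act (inv\<^bsub>GL\<^esub> g) x = x"
    using act_inv_GL(1)[OF G, of x] act_lower_fixed[OF st] xu(1) by (simp add: s_def)
  moreover have "x + y \<in> lower c"
    using xu(1) y(1) lower_mono[of s c] mids_subset_lower by (intro lower_add) (auto simp: s_def)
  ultimately show ?thesis by (simp add: xu(3) act_add[OF rf(1)])
qed

lemma subgroup_Q:
  assumes \<alpha>: "\<alpha> \<in> index_pairs"
  shows "subgroup (Q \<alpha> :: 'k::field imat set) GL"
proof -
  interpret group "GL :: 'k imat monoid" by (rule group_GL)
  have ab: "fst \<alpha> \<le> snd \<alpha>" using \<alpha> by (simp add: index_pairs_def)
  show ?thesis
  proof (rule subgroupI)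
    show "Q \<alpha> \<subseteq> carrier GL" by (auto simp: Q_def)
    have "act imat_one v = v" for v :: "'k col"
      by (rule act_identity_columns) simp
    then have "\<one>\<^bsub>GL\<^esub> \<in> (Q \<alpha> :: 'k imat set)" unfolding Q_iff[OF \<alpha>]
      using one_closed
      by (simp add: GL_one lower_0)
    then show "(Q \<alpha> :: 'k imat set) \<noteq> {}" by blast
  next
    fix g :: "'k imat" assume g: "g \<in> Q \<alpha>"
    then have G: "g \<in> carrier GL" by (simp add: Q_def)
    have rf: "row_finite (inv\<^bsub>GL\<^esub> g)" using G GL_row_finite by auto
    have "act (inv\<^bsub>GL\<^esub> g) u - u \<in> lower (fst \<alpha>)" if "u \<in> mids (fst \<alpha>) (snd \<alpha>)" for u
    proof -
      have "act g u - u \<in> lower (fst \<alpha>)" using g that by (simp add: Q_iff[OF \<alpha>])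
      then have "act (inv\<^bsub>GL\<^esub> g) (act g u - u) \<in> lower (fst \<alpha>)"
        using g G by (intro act_inv_lower) (auto simp: Q_iff[OF \<alpha>])
      then have "u - act (inv\<^bsub>GL\<^esub> g) u \<in> lower (fst \<alpha>)"
        by (simp add: act_diff[OF rf] act_inv_GL(1)[OF G])
      from lower_diff[OF lower_0 this] show ?thesis by simp
    qed
    then show "inv\<^bsub>GL\<^esub> g \<in> Q \<alpha>"
      using g G act_inv_lower[OF G] by (auto simp: Q_iff[OF \<alpha>])
  next
    fix g h :: "'k imat" assume g: "g \<in> Q \<alpha>" and h: "h \<in> Q \<alpha>"
    then have G: "g \<in> carrier GL" "h \<in> carrier GL" by (auto simp: Q_def)
    note rf = G[THEN GL_row_finite]
    have gh: "act (imat_mult g h) v = act g (act h v)" for v by (rule act_imat_mult[OF rf])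
    have "act g (act h u) - u \<in> lower (fst \<alpha>)" if u: "u \<in> mids (fst \<alpha>) (snd \<alpha>)" for u
    proof -
      have "act g (act h u - u) \<in> lower (fst \<alpha>)" "act g u - u \<in> lower (fst \<alpha>)"
        using g h u by (auto simp: Q_iff[OF \<alpha>])
      from lower_add[OF this] show ?thesis by (simp add: act_diff[OF rf(1)])
    qed
    moreover have "imat_mult g h \<in> carrier GL" using m_closed[OF G] by (simp add: GL_mult)
    ultimately show "g \<otimes>\<^bsub>GL\<^esub> h \<in> Q \<alpha>" unfolding GL_mult using g h by (simp add: Q_iff[OF \<alpha>] gh)
  qed
qed

lemma act_Q_decomposition:
  assumes \<alpha>: "\<alpha> \<in> index_pairs" and g: "g \<in> Q \<alpha>"
    and x: "x \<in> lower (fst \<alpha>)" and u: "u \<in> mids (fst \<alpha>) (snd \<alpha>)"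
  obtains x' where "x' \<in> lower (fst \<alpha>)" "act g (x + u) = x' + u"
proof
  have rf: "row_finite g" using g GL_row_finite by (auto simp: Q_def)
  have "act g x \<in> lower (fst \<alpha>)" "act g u - u \<in> lower (fst \<alpha>)"
    using g x u by (auto simp: Q_iff[OF \<alpha>])
  then show "act g x + (act g u - u) \<in> lower (fst \<alpha>)" by (rule lower_add)
  show "act g (x + u) = (act g x + (act g u - u)) + u" by (simp add: act_add[OF rf])
qed

lemma chi_mat_iff:
  "(v, u) \<in> chi_mat \<alpha> \<beta> A \<longleftrightarrow> v \<in> mids (fst \<beta>) (snd \<beta>) \<and> u \<in> mids (fst \<alpha>) (snd \<alpha>) \<and>
    (\<exists>x\<in>lower (fst \<alpha>). \<exists>y\<in>lower (fst \<beta>). act A (y + v) = x + u)"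
  unfolding chi_mat_def col_minus_eq_lower col_mid_eq_mids by (auto simp: eq_commute)

text \<open>A solution of \<open>A (y + v) = x + u\<close> is transported by \<open>g\<close> on the left and \<open>h\<inverse>\<close> on the right, both of
  which leave the middle components \<open>u\<close> and \<open>v\<close> unchanged. As \<open>A\<close> arises from \<open>A'\<close> by the inverses of
  \<open>g\<close> and \<open>h\<close>, the inclusion is all that has to be proved.\<close>

lemma chi_mat_subset:
  assumes \<alpha>: "\<alpha> \<in> index_pairs" and \<beta>: "\<beta> \<in> index_pairs" and g: "g \<in> Q \<alpha>" and h: "h \<in> Q \<beta>"
    and A': "\<And>v. act A' v = act g (act A (act h v))"
  shows "chi_mat \<alpha> \<beta> A \<subseteq> chi_mat \<alpha> \<beta> A'"
proof clarify
  fix v u assume "(v, u) \<in> chi_mat \<alpha> \<beta> A"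
  then obtain x y where vu: "v \<in> mids (fst \<beta>) (snd \<beta>)" "u \<in> mids (fst \<alpha>) (snd \<alpha>)"
    and x: "x \<in> lower (fst \<alpha>)" and y: "y \<in> lower (fst \<beta>)" and eq: "act A (y + v) = x + u"
    by (auto simp: chi_mat_iff)
  have G: "h \<in> carrier GL" using h by (simp add: Q_def)
  have "inv\<^bsub>GL\<^esub> h \<in> Q \<beta>" using subgroup.m_inv_closed[OF subgroup_Q[OF \<beta>] h] .
  from act_Q_decomposition[OF \<beta> this y vu(1)] obtain y' where
    y': "y' \<in> lower (fst \<beta>)" "act (inv\<^bsub>GL\<^esub> h) (y + v) = y' + v" .
  obtain x' where x': "x' \<in> lower (fst \<alpha>)" "act g (x + u) = x' + u"
    using act_Q_decomposition[OF \<alpha> g x vu(2)] .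
  have "act A' (y' + v) = x' + u"
    unfolding A' y'(2)[symmetric] by (simp add: act_inv_GL(2)[OF G] eq x')
  then show "(v, u) \<in> chi_mat \<alpha> \<beta> A'" using vu x' y' by (auto simp: chi_mat_iff)
qed

text \<open>Since \<open>g\<close> preserves \<open>lower \<alpha>\<^sub>+\<close>, it induces a map on the quotient by this space, which \<open>above \<alpha>\<^sub>+\<close>
  identifies with the third summand; and \<open>h\<close> preserves \<open>lower \<beta>\<^sub>-\<close>. So the space of dimension \<open>\<eta>(A')\<close>
  lies in a linear image of the one of dimension \<open>\<eta>(A)\<close>.\<close>

lemma eta_mat_le:
  assumes \<alpha>: "\<alpha> \<in> index_pairs" and \<beta>: "\<beta> \<in> index_pairs" and g: "g \<in> Q \<alpha>" and h: "h \<in> Q \<beta>"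
    and A: "A \<in> carrier finitary_monoid" and A'F: "A' \<in> carrier finitary_monoid"
    and A': "\<And>v. act A' v = act g (act A (act h v))"
  shows "eta_mat \<alpha> \<beta> A' \<le> eta_mat \<alpha> \<beta> A"
proof -
  let ?E = "\<lambda>A. (\<lambda>v. above (snd \<alpha>) (act A v)) ` lower (fst \<beta>)"
  obtain s t where st: "one_outside s t A" using A by (auto simp: finitary_iff_one_outside)
  obtain s' t' where st': "one_outside s' t' A'" using A'F by (auto simp: finitary_iff_one_outside)
  have rf: "row_finite g" using g GL_row_finite by (auto simp: Q_def)
  have sub: "col.subspace (?E A)" if "row_finite A" for A :: "'a imat"
    by (rule subspace_image[OF linear_above_act[OF that] subspace_lower])
  let ?p = "\<lambda>v. above (snd \<alpha>) (act g v)"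
  have lin: "Vector_Spaces.linear col_scale col_scale ?p" by (rule linear_above_act[OF rf])
  have fA: "fin_dim (?E A)" by (rule eta_mat_eq_dim(2)[OF st])
  have sA: "col.subspace (?E A)" by (rule sub[OF row_finite_one_outside[OF st]])
  have "?E A' \<subseteq> ?p ` ?E A"
  proof clarify
    fix v :: "'a col" assume v: "v \<in> lower (fst \<beta>)"
    let ?z = "act A (act h v)"
    have hv: "act h v \<in> lower (fst \<beta>)" using h v by (simp add: Q_iff[OF \<beta>])
    then have fin: "finite {j. ?z j \<noteq> 0}" by (intro finite_support_act[OF st]) (rule finite_support_lower)
    then have "?z - above (snd \<alpha>) ?z \<in> lower (snd \<alpha>)"
      by (auto simp: lower_def above_def elim: finite_subset[rotated])
    then have "act g (?z - above (snd \<alpha>) ?z) \<in> lower (snd \<alpha>)" using g by (simp add: Q_iff[OF \<alpha>])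
    then have "above (snd \<alpha>) (act g (?z - above (snd \<alpha>) ?z)) = 0" by (rule above_lower)
    moreover have "act g ?z = act g (?z - above (snd \<alpha>) ?z) + act g (above (snd \<alpha>) ?z)"
      by (simp add: act_diff[OF rf])
    ultimately have "above (snd \<alpha>) (act A' v) = ?p (above (snd \<alpha>) ?z)"
      by (simp add: A' above_add)
    then show "above (snd \<alpha>) (act A' v) \<in> ?p ` ?E A" using hv by blast
  qed
  then have "col.dim (?E A') \<le> col.dim (?p ` ?E A)"
    by (intro dim_mono subspace_image[OF lin sA] fin_dim_image[OF lin fA]
        sub row_finite_one_outside[OF st'])
  also have "\<dots> \<le> col.dim (?E A)" using rank_nullity[OF lin sA fA] by linarith
  finally show ?thesis by (simp add: eta_mat_eq_dim(1)[OF st] eta_mat_eq_dim(1)[OF st'])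
qed

lemma dcoset_iff:
  "X \<in> dcoset \<alpha> \<beta> A \<longleftrightarrow> (\<exists>g\<in>Q \<alpha>. \<exists>h\<in>Q \<beta>. X = imat_mult (imat_mult g A) h)"
  unfolding dcoset_def r_coset_def set_mult_def by (auto simp: GL_mult)

lemma invariants_dcoset:
  assumes \<alpha>: "\<alpha> \<in> index_pairs" and \<beta>: "\<beta> \<in> index_pairs" and A: "A \<in> carrier finitary_monoid"
    and X: "X \<in> dcoset \<alpha> \<beta> A"
  shows "chi_mat \<alpha> \<beta> X = chi_mat \<alpha> \<beta> A" and "eta_mat \<alpha> \<beta> X = eta_mat \<alpha> \<beta> A"
proof -
  obtain g h where g: "g \<in> Q \<alpha>" and h: "h \<in> Q \<beta>" and Xe: "X = imat_mult (imat_mult g A) h"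
    using X by (auto simp: dcoset_iff)
  have G: "g \<in> carrier GL" "h \<in> carrier GL" using g h by (auto simp: Q_def)
  then have F: "g \<in> carrier finitary_monoid" "h \<in> carrier finitary_monoid"
    by (auto simp: GL_def units_of_def Units_def)
  note rf = F[THEN row_finite_finitary] A[THEN row_finite_finitary]
  have Xact: "act X v = act g (act A (act h v))" for v
    by (simp add: Xe act_imat_mult rf row_finite_imat_mult)
  have Aact: "act A v = act (inv\<^bsub>GL\<^esub> g) (act X (act (inv\<^bsub>GL\<^esub> h) v))" for v
    by (simp add: Xact act_inv_GL G)
  have inv: "inv\<^bsub>GL\<^esub> g \<in> Q \<alpha>" "inv\<^bsub>GL\<^esub> h \<in> Q \<beta>"
    using subgroup.m_inv_closed[OF subgroup_Q[OF \<alpha>] g] subgroup.m_inv_closed[OF subgroup_Q[OF \<beta>] h] .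
  interpret M: monoid "finitary_monoid :: 'a imat monoid" by (rule monoid_finitary)
  have XF: "X \<in> carrier finitary_monoid"
    using M.m_closed[OF M.m_closed[OF F(1) A] F(2)] by (simp add: Xe finitary_monoid_def)
  show "chi_mat \<alpha> \<beta> X = chi_mat \<alpha> \<beta> A"
    using chi_mat_subset[OF \<alpha> \<beta> g h Xact] chi_mat_subset[OF \<alpha> \<beta> inv Aact] by blast
  show "eta_mat \<alpha> \<beta> X = eta_mat \<alpha> \<beta> A"
    using eta_mat_le[OF \<alpha> \<beta> g h A XF Xact] eta_mat_le[OF \<alpha> \<beta> inv XF A Aact] by (rule antisym)
qed

lemma dcoset_refl:
  assumes \<alpha>: "\<alpha> \<in> index_pairs" and \<beta>: "\<beta> \<in> index_pairs" and A: "A \<in> carrier finitary_monoid"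
  shows "A \<in> dcoset \<alpha> \<beta> A"
proof -
  interpret M: monoid "finitary_monoid :: 'a imat monoid" by (rule monoid_finitary)
  have "A = imat_mult (imat_mult imat_one A) imat_one"
    using M.l_one[OF A] M.r_one[OF A] by (simp add: finitary_monoid_def)
  moreover have "imat_one \<in> (Q \<alpha> :: 'a imat set)" "imat_one \<in> (Q \<beta> :: 'a imat set)"
    using subgroup.one_closed[OF subgroup_Q[OF \<alpha>]] subgroup.one_closed[OF subgroup_Q[OF \<beta>]]
    unfolding GL_one .
  ultimately show ?thesis unfolding dcoset_iff by blast
qed

lemma
  assumes \<alpha>: "\<alpha> \<in> index_pairs" and \<beta>: "\<beta> \<in> index_pairs" and A: "A \<in> carrier finitary_monoid"
  shows chi_dcoset: "chi \<alpha> \<beta> (dcoset \<alpha> \<beta> A) = chi_mat \<alpha> \<beta> A"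
    and eta_dcoset: "eta \<alpha> \<beta> (dcoset \<alpha> \<beta> A) = eta_mat \<alpha> \<beta> A"
proof -
  have "chi_mat \<alpha> \<beta> ` dcoset \<alpha> \<beta> A = {chi_mat \<alpha> \<beta> A}" "eta_mat \<alpha> \<beta> ` dcoset \<alpha> \<beta> A = {eta_mat \<alpha> \<beta> A}"
    using invariants_dcoset[OF \<alpha> \<beta> A] dcoset_refl[OF \<alpha> \<beta> A] by blast+
  then show "chi \<alpha> \<beta> (dcoset \<alpha> \<beta> A) = chi_mat \<alpha> \<beta> A" "eta \<alpha> \<beta> (dcoset \<alpha> \<beta> A) = eta_mat \<alpha> \<beta> A"
    by (simp_all add: chi_def eta_def)
qed

lemma dcoset_subset:
  fixes A :: "'k::field imat"
  assumes \<alpha>: "\<alpha> \<in> index_pairs" and \<beta>: "\<beta> \<in> index_pairs" and A: "A \<in> carrier GL"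
    and g: "g \<in> Q \<alpha>" and h: "h \<in> Q \<beta>"
  shows "dcoset \<alpha> \<beta> (g \<otimes>\<^bsub>GL\<^esub> A \<otimes>\<^bsub>GL\<^esub> h) \<subseteq> dcoset \<alpha> \<beta> A"
proof
  interpret group "GL :: 'k imat monoid" by (rule group_GL)
  fix Y assume "Y \<in> dcoset \<alpha> \<beta> (g \<otimes>\<^bsub>GL\<^esub> A \<otimes>\<^bsub>GL\<^esub> h)"
  then obtain p q where p: "p \<in> Q \<alpha>" and q: "q \<in> Q \<beta>"
    and Y: "Y = p \<otimes>\<^bsub>GL\<^esub> (g \<otimes>\<^bsub>GL\<^esub> A \<otimes>\<^bsub>GL\<^esub> h) \<otimes>\<^bsub>GL\<^esub> q"
    by (auto simp: dcoset_iff GL_mult)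
  have C: "g \<in> carrier GL" "h \<in> carrier GL" "p \<in> carrier GL" "q \<in> carrier GL"
    using g h p q by (auto simp: Q_def)
  have "Y = (p \<otimes>\<^bsub>GL\<^esub> g) \<otimes>\<^bsub>GL\<^esub> A \<otimes>\<^bsub>GL\<^esub> (h \<otimes>\<^bsub>GL\<^esub> q)" using C A by (simp add: Y m_assoc)
  moreover have "p \<otimes>\<^bsub>GL\<^esub> g \<in> Q \<alpha>" "h \<otimes>\<^bsub>GL\<^esub> q \<in> Q \<beta>"
    using subgroup.m_closed[OF subgroup_Q[OF \<alpha>] p g] subgroup.m_closed[OF subgroup_Q[OF \<beta>] h q] .
  ultimately show "Y \<in> dcoset \<alpha> \<beta> A" by (auto simp: dcoset_iff GL_mult)
qed

lemma dcoset_eq: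
  fixes A :: "'k::field imat"
  assumes \<alpha>: "\<alpha> \<in> index_pairs" and \<beta>: "\<beta> \<in> index_pairs" and A: "A \<in> carrier GL"
    and g: "g \<in> Q \<alpha>" and h: "h \<in> Q \<beta>"
  shows "dcoset \<alpha> \<beta> (g \<otimes>\<^bsub>GL\<^esub> A \<otimes>\<^bsub>GL\<^esub> h) = dcoset \<alpha> \<beta> A"
proof
  interpret group "GL :: 'k imat monoid" by (rule group_GL)
  let ?X = "g \<otimes>\<^bsub>GL\<^esub> A \<otimes>\<^bsub>GL\<^esub> h"
  show "dcoset \<alpha> \<beta> ?X \<subseteq> dcoset \<alpha> \<beta> A" by (rule dcoset_subset[OF assms])
  have C: "g \<in> carrier GL" "h \<in> carrier GL" using g h by (auto simp: Q_def)
  have "inv\<^bsub>GL\<^esub> g \<otimes>\<^bsub>GL\<^esub> ?X \<otimes>\<^bsub>GL\<^esub> inv\<^bsub>GL\<^esub> h = A"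
  proof -
    have "inv\<^bsub>GL\<^esub> g \<otimes>\<^bsub>GL\<^esub> ?X \<otimes>\<^bsub>GL\<^esub> inv\<^bsub>GL\<^esub> h
        = (inv\<^bsub>GL\<^esub> g \<otimes>\<^bsub>GL\<^esub> g) \<otimes>\<^bsub>GL\<^esub> A \<otimes>\<^bsub>GL\<^esub> (h \<otimes>\<^bsub>GL\<^esub> inv\<^bsub>GL\<^esub> h)"
      using C A by (simp only: m_assoc m_closed inv_closed)
    then show ?thesis using C A by simp
  qed
  moreover have "dcoset \<alpha> \<beta> (inv\<^bsub>GL\<^esub> g \<otimes>\<^bsub>GL\<^esub> ?X \<otimes>\<^bsub>GL\<^esub> inv\<^bsub>GL\<^esub> h) \<subseteq> dcoset \<alpha> \<beta> ?X"
    using C A subgroup.m_inv_closed[OF subgroup_Q[OF \<alpha>] g] subgroup.m_inv_closed[OF subgroup_Q[OF \<beta>] h]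
    by (intro dcoset_subset[OF \<alpha> \<beta>]) auto
  ultimately show "dcoset \<alpha> \<beta> A \<subseteq> dcoset \<alpha> \<beta> ?X" by simp
qed

text \<open>Inverting \<open>g A h\<close> gives \<open>h\<inverse> A\<inverse> g\<inverse>\<close>, which lies in the double coset of \<open>A\<inverse>\<close>.\<close>

lemma star_inv_dcoset:
  fixes A :: "'k::field imat"
  assumes \<alpha>: "\<alpha> \<in> index_pairs" and \<beta>: "\<beta> \<in> index_pairs" and A: "A \<in> carrier GL"
  shows "star_inv \<alpha> \<beta> (dcoset \<alpha> \<beta> A) = dcoset \<beta> \<alpha> (inv\<^bsub>GL\<^esub> A)"
proof -
  interpret group "GL :: 'k imat monoid" by (rule group_GL)
  have *: "dcoset \<beta> \<alpha> (inv\<^bsub>GL\<^esub> X) = dcoset \<beta> \<alpha> (inv\<^bsub>GL\<^esub> A)" if "X \<in> dcoset \<alpha> \<beta> A" for X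
  proof -
    obtain g h where g: "g \<in> Q \<alpha>" and h: "h \<in> Q \<beta>" and X: "X = g \<otimes>\<^bsub>GL\<^esub> A \<otimes>\<^bsub>GL\<^esub> h"
      using \<open>X \<in> dcoset \<alpha> \<beta> A\<close> by (auto simp: dcoset_iff GL_mult)
    have C: "g \<in> carrier GL" "h \<in> carrier GL" using g h by (auto simp: Q_def)
    have X': "inv\<^bsub>GL\<^esub> X = inv\<^bsub>GL\<^esub> h \<otimes>\<^bsub>GL\<^esub> inv\<^bsub>GL\<^esub> A \<otimes>\<^bsub>GL\<^esub> inv\<^bsub>GL\<^esub> g"
      using C A by (simp only: X inv_mult_group m_assoc m_closed inv_closed)
    show ?thesis unfolding X'
      by (rule dcoset_eq[OF \<beta> \<alpha> inv_closed[OF A] subgroup.m_inv_closed[OF subgroup_Q[OF \<beta>] h]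
          subgroup.m_inv_closed[OF subgroup_Q[OF \<alpha>] g]])
  qed
  have "A \<in> carrier finitary_monoid" using A by (auto simp: GL_def units_of_def Units_def)
  from dcoset_refl[OF \<alpha> \<beta> this]
  have "(\<lambda>A. dcoset \<beta> \<alpha> (inv\<^bsub>GL\<^esub> A)) ` dcoset \<alpha> \<beta> A = {dcoset \<beta> \<alpha> (inv\<^bsub>GL\<^esub> A)}"
    using * by blast
  then show ?thesis by (simp add: star_inv_def)
qed

section \<open>Entries of the product matrix\<close>

text \<open>The permutation that exchanges the adjacent blocks \<open>p < i \<le> q\<close> and \<open>q < i \<le> r\<close>, keeping the order
  inside each block.\<close>

definition exch :: "int \<Rightarrow> int \<Rightarrow> int \<Rightarrow> int \<Rightarrow> int" where
  "exch p q r i = (if p < i \<and> i \<le> q then i + (r - q) else if q < i \<and> i \<le> r then i - (q - p) else i)"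

text \<open>The matrix \<open>B\<^sup>\<lozenge>\<close> has in row \<open>m\<close> and column \<open>j\<close> the entry of \<open>B\<close> in row \<open>row_perm m\<close> and column
  \<open>col_perm j\<close>. Both row blocks exchanged on the same side of \<open>\<beta>\<close> have equal size, so \<open>row_perm\<close> is an
  involution. The column blocks exchanged by \<open>col_perm\<close> have different sizes in general, but they lie
  on the same side of \<open>\<gamma>\<close>, so that \<open>col_perm\<close> permutes the columns within the blocks of \<open>\<gamma>\<close>.\<close>

definition row_perm :: "int \<times> int \<Rightarrow> int \<Rightarrow> int \<Rightarrow> int \<Rightarrow> int" where
  "row_perm \<beta> s t = exch (s - (fst \<beta> - s)) s (fst \<beta>) \<circ> exch (snd \<beta>) t (t + (t - snd \<beta>))"

definition col_perm :: "int \<times> int \<Rightarrow> int \<times> int \<Rightarrow> int \<Rightarrow> int \<Rightarrow> int \<Rightarrow> int" where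
  "col_perm \<beta> \<gamma> s t =
     exch (s - (fst \<beta> - s)) (fst \<gamma> - (fst \<beta> - s)) (fst \<gamma>) \<circ>
     exch (snd \<gamma>) (snd \<gamma> + (t - snd \<beta>)) (t + (t - snd \<beta>))"

lemma locate_sound:
  assumes "i < sum_list rs"
  shows "fst (locate rs i) < length rs \<and> snd (locate rs i) < rs ! fst (locate rs i) \<and>
    i = sum_list (take (fst (locate rs i)) rs) + snd (locate rs i)"
  using assms
proof (induction rs arbitrary: i)
  case (Cons r rs)
  show ?case
  proof (cases "i < r")
    case False
    then have "i - r < sum_list rs" using Cons.prems by simp
    from Cons.IH[OF this] False show ?thesis by (auto simp: apfst_def map_prod_def split_beta)
  qed simp
qed simp

text \<open>A block matrix has the entries of \<open>F\<close> as soon as every block has, with indices shifted by the sizes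
  of the preceding blocks.\<close>

lemma block_mat_entry:
  assumes "i < sum_list rs" "j < sum_list cs"
    and "\<And>p q i' j'. p < length rs \<Longrightarrow> q < length cs \<Longrightarrow> i' < rs ! p \<Longrightarrow> j' < cs ! q \<Longrightarrow>
      (Bs ! p ! q) i' j' = F (sum_list (take p rs) + i') (sum_list (take q cs) + j')"
  shows "block_mat rs cs Bs $$ (i, j) = F i j"
proof -
  obtain p i' q j' where l: "locate rs i = (p, i')" "locate cs j = (q, j')" by fastforce
  then have "block_mat rs cs Bs $$ (i, j) = (Bs ! p ! q) i' j'"
    using assms(1,2) by (simp add: block_mat_def)
  also have "\<dots> = F i j"
    using assms(3)[of p q i' j'] locate_sound[OF assms(1)] locate_sound[OF assms(2)] l by simp
  finally show ?thesis .
qed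

text \<open>The zero and identity blocks of the definitions are parts of \<open>A\<close> (or \<open>B\<close>) as well, lying outside the
  square where the matrix deviates from the identity. The next three lemmas compare each of the three kinds
  of blocks with the entry at its place.\<close>

lemma zero_entry:
  "one_outside s t A \<Longrightarrow> (s < x \<Longrightarrow> x \<le> t \<Longrightarrow> s < y \<Longrightarrow> y \<le> t \<Longrightarrow> False) \<Longrightarrow> x \<noteq> y \<Longrightarrow>
    zero_block i j = A x y"
  using one_outsideD[of s t A x y] by (auto simp: zero_block_def imat_one_def)

lemma one_entry:
  "one_outside s t A \<Longrightarrow> (s < x \<Longrightarrow> x \<le> t \<Longrightarrow> s < y \<Longrightarrow> y \<le> t \<Longrightarrow> False) \<Longrightarrow> x - y = int i - int j \<Longrightarrow>
    one_block i j = A x y"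
proof -
  assume o: "one_outside s t A" and x: "s < x \<Longrightarrow> x \<le> t \<Longrightarrow> s < y \<Longrightarrow> y \<le> t \<Longrightarrow> False"
    and e: "x - y = int i - int j"
  have "A x y = imat_one x y" using x by (intro one_outsideD[OF o]) blast
  moreover have "i = j \<longleftrightarrow> x = y" using e by linarith
  ultimately show ?thesis by (simp add: one_block_def imat_one_def)
qed

lemma sub_entry:
  "x = r + 1 + int i \<Longrightarrow> y = c + 1 + int j \<Longrightarrow> sub_block A r c i j = A x y"
  by (simp add: sub_block_def)

text \<open>The matrix \<open>A\<^sup>\<circ>\<close> is a window of \<open>A\<close>: each block stands in its original place, and the identity
  blocks added at the border are the values of \<open>A\<close> there. The sizes are natural numbers here, so that
  every comparison of indices is linear arithmetic.\<close>

lemma circ_entry: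
  fixes Mm Nm wa Np Mp wb i j :: nat and s t :: int
  assumes A: "one_outside s t A"
    and t: "t = s + int (Nm + wa + Np)" "t = s + int (Mm + wb + Mp)"
    and i: "i < Mm + Nm + wa + Np + Mp" and j: "j < Mm + Mm + wb + Mp + Mp"
  shows "block_mat [Mm, Nm, wa, Np, Mp] [Mm, Mm, wb, Mp, Mp]
      [[one_block, zero_block, zero_block, zero_block, zero_block],
       [zero_block, sub_block A s s, sub_block A s (s + int Mm), sub_block A s (s + int Mm + int wb), zero_block],
       [zero_block, sub_block A (s + int Nm) s, sub_block A (s + int Nm) (s + int Mm),
          sub_block A (s + int Nm) (s + int Mm + int wb), zero_block],
       [zero_block, sub_block A (s + int Nm + int wa) s, sub_block A (s + int Nm + int wa) (s + int Mm),
          sub_block A (s + int Nm + int wa) (s + int Mm + int wb), zero_block],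
       [zero_block, zero_block, zero_block, zero_block, one_block]] $$ (i, j)
    = A (s - int Mm + 1 + int i) (s - int Mm + 1 + int j)"
proof (rule block_mat_entry[where F = "\<lambda>i j. A (s - int Mm + 1 + int i) (s - int Mm + 1 + int j)"], goal_cases)
  case (3 p q i' j')
  then have "p \<in> {0, 1, 2, 3, 4}" "q \<in> {0, 1, 2, 3, 4}" by auto
  then show ?case using 3(3,4)
    apply (elim insertE emptyE)
    apply (simp_all)
    apply (((rule sub_entry; (use t in linarith)) | (rule zero_entry[OF A]; (use t in linarith))
          | (rule one_entry[OF A]; (use t in linarith)))+)
    done
qed (use i j in simp_all)

text \<open>The five row blocks of \<open>B\<^sup>\<lozenge>\<close> are \<open>b\<^sub>1\<close>, an identity block, \<open>b\<^sub>2\<close>, an identity block and \<open>b\<^sub>3\<close>. The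
  permutations send \<open>b\<^sub>1\<close> and \<open>b\<^sub>3\<close> back to their places in \<open>B\<close>, and the identity blocks to the
  places outside the square, where \<open>B\<close> is the identity.\<close>

lemma lozenge_entry:
  fixes Mm Km wb wc Mp Kp i j :: nat and s t :: int and \<beta> \<gamma> :: "int \<times> int"
  defines "\<sigma> \<equiv> row_perm \<beta> s t" and "\<tau> \<equiv> col_perm \<beta> \<gamma> s t"
  assumes B: "one_outside s t B"
    and \<beta>: "fst \<beta> = s + int Mm" "snd \<beta> = s + int Mm + int wb"
    and \<gamma>: "fst \<gamma> = s + int Km" "snd \<gamma> = s + int Km + int wc"
    and t: "t = s + int (Mm + wb + Mp)" "t = s + int (Km + wc + Kp)"
    and i: "i < Mm + Mm + wb + Mp + Mp" and j: "j < Km + Mm + wc + Mp + Kp"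
  shows "block_mat [Mm, Mm, wb, Mp, Mp] [Km, Mm, wc, Mp, Kp]
      [[sub_block B s s, zero_block, sub_block B s (s + int Km), zero_block, sub_block B s (s + int Km + int wc)],
       [zero_block, one_block, zero_block, zero_block, zero_block],
       [sub_block B (s + int Mm) s, zero_block, sub_block B (s + int Mm) (s + int Km), zero_block,
          sub_block B (s + int Mm) (s + int Km + int wc)],
       [zero_block, zero_block, zero_block, one_block, zero_block],
       [sub_block B (s + int Mm + int wb) s, zero_block, sub_block B (s + int Mm + int wb) (s + int Km), zero_block,
          sub_block B (s + int Mm + int wb) (s + int Km + int wc)]] $$ (i, j)
    = B (\<sigma> (s - int Mm + 1 + int i)) (\<tau> (s - int Mm + 1 + int j))"
proof -
  define X Y where "X i = \<sigma> (s - int Mm + 1 + int i)" and "Y j = \<tau> (s - int Mm + 1 + int j)" for i j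
  have widths: "fst \<beta> - s = int Mm" "t - snd \<beta> = int Mp" using \<beta> t(1) by simp_all
  have X: "i' < Mm \<Longrightarrow> X i' = s + 1 + int i'"
    "i' < Mm \<Longrightarrow> X (Mm + i') = s - int Mm + 1 + int i'"
    "i' < wb \<Longrightarrow> X (Mm + (Mm + i')) = s + int Mm + 1 + int i'"
    "i' < Mp \<Longrightarrow> X (Mm + (Mm + (wb + i'))) = t + 1 + int i'"
    "i' < Mp \<Longrightarrow> X (Mm + (Mm + (wb + (Mp + i')))) = s + int Mm + int wb + 1 + int i'" for i'
    unfolding X_def \<sigma>_def row_perm_def widths by (simp_all add: exch_def \<beta> t(1))
  have Y: "j' < Km \<Longrightarrow> Y j' = s + 1 + int j'"
    "j' < Mm \<Longrightarrow> Y (Km + j') = s - int Mm + 1 + int j'"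
    "j' < wc \<Longrightarrow> Y (Km + (Mm + j')) = s + int Km + 1 + int j'"
    "j' < Mp \<Longrightarrow> Y (Km + (Mm + (wc + j'))) = t + 1 + int j'"
    "j' < Kp \<Longrightarrow> Y (Km + (Mm + (wc + (Mp + j')))) = s + int Km + int wc + 1 + int j'" for j'
    unfolding Y_def \<tau>_def col_perm_def widths by (simp_all add: exch_def \<gamma> t(2))
  show ?thesis unfolding X_def[symmetric] Y_def[symmetric]
  proof (rule block_mat_entry[where F = "\<lambda>i j. B (X i) (Y j)"], goal_cases)
    case (3 p q i' j')
    then have "p \<in> {0, 1, 2, 3, 4}" "q \<in> {0, 1, 2, 3, 4}" by auto
    then show ?case using 3(3,4)
      apply (elim insertE emptyE)
      apply (simp_all add: X Y add.assoc)
      apply (((rule sub_entry; (use t in linarith)) | (rule zero_entry[OF B]; (use t in linarith))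
            | (rule one_entry[OF B]; (use t in linarith)))+)
      done
  qed (use i j in simp_all)
qed

lemma exch_inverse:
  assumes "p \<le> q" "q \<le> r"
  shows "exch p (p + r - q) r (exch p q r i) = i"
  using assms by (auto simp: exch_def)

lemma bij_exch:
  assumes "p \<le> q" "q \<le> r"
  shows "bij (exch p q r)"
proof (rule o_bij)
  show "exch p (p + r - q) r \<circ> exch p q r = id" using exch_inverse[OF assms] by auto
  show "exch p q r \<circ> exch p (p + r - q) r = id"
    using exch_inverse[of p "p + r - q" r] assms by auto
qed

text \<open>One choice of representatives and of a square, as in the definition of the product.\<close>

locale star_choice_data =
  fixes \<alpha> \<beta> \<gamma> :: "int \<times> int" and s t :: int and A B :: "'k::field imat"
  assumes \<alpha>: "\<alpha> \<in> index_pairs" and \<beta>: "\<beta> \<in> index_pairs" and \<gamma>: "\<gamma> \<in> index_pairs"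
    and s_le: "s \<le> fst \<alpha>" "s \<le> fst \<beta>" "s \<le> fst \<gamma>"
    and t_ge: "snd \<alpha> \<le> t" "snd \<beta> \<le> t" "snd \<gamma> \<le> t"
    and A: "one_outside s t A" and B: "one_outside s t B"
begin

abbreviation "\<sigma> \<equiv> row_perm \<beta> s t"
abbreviation "\<tau> \<equiv> col_perm \<beta> \<gamma> s t"

lemma le: "fst \<alpha> \<le> snd \<alpha>" "fst \<beta> \<le> snd \<beta>" "fst \<gamma> \<le> snd \<gamma>"
  using \<alpha> \<beta> \<gamma> by (auto simp: index_pairs_def)

text \<open>The effect of \<open>\<sigma>\<close> on the decomposition for \<open>\<beta>\<close>: it preserves the three ranges, is the identity on the
  middle one, and moves what lies in the square on either side out of the square.\<close>

lemma \<sigma>_involution: "\<sigma> (\<sigma> i) = i"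
  and \<sigma>_mid: "fst \<beta> < i \<Longrightarrow> i \<le> snd \<beta> \<Longrightarrow> \<sigma> i = i"
  and \<sigma>_minus: "s < i \<Longrightarrow> i \<le> fst \<beta> \<Longrightarrow> \<sigma> i \<le> s"
  and \<sigma>_plus: "snd \<beta> < i \<Longrightarrow> i \<le> t \<Longrightarrow> t < \<sigma> i"
  and \<sigma>_le: "\<sigma> i \<le> fst \<beta> \<longleftrightarrow> i \<le> fst \<beta>"
  and \<sigma>_gt: "snd \<beta> < \<sigma> i \<longleftrightarrow> snd \<beta> < i"
  using s_le t_ge le by (simp_all add: row_perm_def exch_def)

lemma \<sigma>_outside: "i \<le> s - (fst \<beta> - s) \<or> t + (t - snd \<beta>) < i \<Longrightarrow> \<sigma> i = i"
  using s_le t_ge le by (auto simp: row_perm_def exch_def)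

lemma \<tau>_mid: "fst \<gamma> < i \<Longrightarrow> i \<le> snd \<gamma> \<Longrightarrow> \<tau> i = i"
  and \<tau>_le: "\<tau> i \<le> fst \<gamma> \<longleftrightarrow> i \<le> fst \<gamma>"
  using s_le t_ge le by (simp_all add: col_perm_def exch_def)

lemma bij_\<tau>: "bij \<tau>"
  unfolding col_perm_def using s_le t_ge le by (intro bij_comp bij_exch) auto

lemma \<tau>_outside: "i \<le> s - (fst \<beta> - s) \<or> t + (t - snd \<beta>) < i \<Longrightarrow> \<tau> i = i"
  using s_le t_ge le by (auto simp: col_perm_def exch_def)

abbreviation "\<tau>' \<equiv> inv_into UNIV \<tau>"

text \<open>Since \<open>A\<^sup>\<circ>\<close> is a window of \<open>A\<close> and \<open>B\<^sup>\<lozenge>\<close> one of a permuted \<open>B\<close>, both the identity outside of their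
  window, the finite product completed by the identity is the product of the infinite matrices.\<close>

lemma star_mat_eq:
  "star_mat \<alpha> \<beta> \<gamma> s t A B = imat_mult A (\<lambda>m j. B (\<sigma> m) (\<tau> j))"
proof (intro ext)
  fix i j
  define Nm wa Np Mm wb Mp Km wc Kp where d:
    "Nm = nat (fst \<alpha> - s)" "wa = width \<alpha>" "Np = nat (t - snd \<alpha>)"
    "Mm = nat (fst \<beta> - s)" "wb = width \<beta>" "Mp = nat (t - snd \<beta>)"
    "Km = nat (fst \<gamma> - s)" "wc = width \<gamma>" "Kp = nat (t - snd \<gamma>)"
  have ends: "fst \<alpha> = s + int Nm" "snd \<alpha> = s + int Nm + int wa"
    "fst \<beta> = s + int Mm" "snd \<beta> = s + int Mm + int wb"
    "fst \<gamma> = s + int Km" "snd \<gamma> = s + int Km + int wc"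
    using s_le t_ge le by (simp_all add: d width_def)
  have t: "t = s + int (Nm + wa + Np)" "t = s + int (Mm + wb + Mp)" "t = s + int (Km + wc + Kp)"
    using s_le t_ge le by (simp_all add: d width_def)
  define n where "n = Mm + Mm + wb + Mp + Mp"
  have n: "n = Mm + Nm + wa + Np + Mp" "n = Km + Mm + wc + Mp + Kp"
    using t by (simp_all add: n_def)
  define p where "p = s - int Mm"
  have q: "t + int Mp = p + int n" using t(2) by (simp add: p_def n_def)
  have C: "circ_mat \<alpha> \<beta> s t A $$ (k, l) = A (p + 1 + int k) (p + 1 + int l)"
    if "k < n" "l < n" for k l
    unfolding circ_mat_def Let_def d[symmetric] unfolding ends p_def
    by (rule circ_entry[OF A t(1,2)]) (use that n n_def in simp_all)
  have L: "lozenge_mat \<beta> \<gamma> s t B $$ (k, l) = B (\<sigma> (p + 1 + int k)) (\<tau> (p + 1 + int l))"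
    if "k < n" "l < n" for k l
    unfolding lozenge_mat_def Let_def d[symmetric]
    unfolding ends p_def
    by (rule lozenge_entry[OF B ends(3-6) t(2,3)]) (use that n n_def in simp_all)
  have dims: "dim_row (circ_mat \<alpha> \<beta> s t A) = n" "dim_col (circ_mat \<alpha> \<beta> s t A) = n"
    "dim_row (lozenge_mat \<beta> \<gamma> s t B) = n" "dim_col (lozenge_mat \<beta> \<gamma> s t B) = n"
    unfolding circ_mat_def lozenge_mat_def Let_def d[symmetric] block_mat_def
    using n by (simp_all add: n_def)
  have pl: "s - (fst \<beta> - s) = p" "t + (t - snd \<beta>) = p + int n"
    using q t(2) by (simp_all add: ends p_def)
  let ?v = "\<lambda>m. B (\<sigma> m) (\<tau> j)"
  show "star_mat \<alpha> \<beta> \<gamma> s t A B i j = imat_mult A (\<lambda>m j. B (\<sigma> m) (\<tau> j)) i j"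
  proof (cases "p < i \<and> i \<le> p + int n")
    case i: True
    show ?thesis
    proof (cases "p < j \<and> j \<le> p + int n")
      case j: True
      define k l where "k = nat (i - p - 1)" and "l = nat (j - p - 1)"
      have kl: "k < n" "l < n" "i = p + 1 + int k" "j = p + 1 + int l"
        using i j by (auto simp: k_def l_def)
      have "star_mat \<alpha> \<beta> \<gamma> s t A B i j = (circ_mat \<alpha> \<beta> s t A * lozenge_mat \<beta> \<gamma> s t B) $$ (k, l)"
        using i j by (simp add: star_mat_def place_def pl k_def l_def)
      also have "\<dots> = (\<Sum>m\<in>{0..<n}. circ_mat \<alpha> \<beta> s t A $$ (k, m) * lozenge_mat \<beta> \<gamma> s t B $$ (m, l))"
        using kl(1,2) by (simp add: dims scalar_prod_def)
      also have "\<dots> = (\<Sum>m\<in>{0..<n}. A i (p + 1 + int m) * ?v (p + 1 + int m))"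
        by (rule sum.cong) (use kl in \<open>simp_all add: C L\<close>)
      also have "\<dots> = (\<Sum>m\<in>(\<lambda>m. p + 1 + int m) ` {0..<n}. A i m * ?v m)"
        by (subst sum.reindex) (auto simp: inj_on_def)
      also have "\<dots> = act A ?v i"
      proof (rule act_eq_sum[symmetric])
        fix m assume "A i m * ?v m \<noteq> 0"
        have "p < m \<and> m \<le> p + int n"
        proof (rule ccontr)
          assume m: "\<not> (p < m \<and> m \<le> p + int n)"
          then have "\<not> (s < m \<and> m \<le> t)" using q by (auto simp: p_def)
          then have "A i m = imat_one i m" by (intro one_outsideD[OF A]) blast
          then show False using m i \<open>A i m * ?v m \<noteq> 0\<close> by (auto simp: imat_one_def split: if_splits)
        qed
        then show "m \<in> (\<lambda>m. p + 1 + int m) ` {0..<n}"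
          by (intro image_eqI[of _ _ "nat (m - p - 1)"]) auto
      qed simp
      finally show ?thesis by (simp add: imat_mult_eq_act)
    next
      case j: False
      then have \<tau>j: "\<tau> j = j" by (intro \<tau>_outside) (auto simp: pl)
      have jst: "\<not> (s < j \<and> j \<le> t)" using j q by (auto simp: p_def)
      have "\<sigma> m = j \<longleftrightarrow> m = j" for m
        using \<sigma>_outside[of j] \<sigma>_involution[of m] \<sigma>_involution[of j] j by (auto simp: pl)
      then have "?v = (\<lambda>m. imat_one m j)"
        using jst by (auto simp: \<tau>j one_outsideD[OF B] imat_one_def)
      moreover have "A i j = imat_one i j" by (rule one_outsideD[OF A]) (use jst in blast)
      ultimately show ?thesis
        using j by (auto simp: imat_mult_eq_act act_unit_column star_mat_def place_def pl)
    qed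
  next
    case i: False
    then have \<sigma>i: "\<sigma> i = i" by (intro \<sigma>_outside) (auto simp: pl)
    have ist: "\<not> (s < i \<and> i \<le> t)" using i q by (auto simp: p_def)
    have "\<tau> i = i" using i by (intro \<tau>_outside) (auto simp: pl)
    then have "i = \<tau> j \<longleftrightarrow> i = j" using injD[OF bij_is_inj[OF bij_\<tau>], of i j] by metis
    moreover have "act A ?v i = ?v i" by (rule act_outside[OF A ist])
    moreover have "B i (\<tau> j) = imat_one i (\<tau> j)" by (rule one_outsideD[OF B]) (use ist in blast)
    ultimately show ?thesis
      using i by (auto simp add: imat_mult_eq_act \<sigma>i star_mat_def place_def pl imat_one_def)
  qed
qed

lemma one_outside_star: "one_outside (s - (fst \<beta> - s)) (t + (t - snd \<beta>)) (star_mat \<alpha> \<beta> \<gamma> s t A B)"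
  unfolding one_outside_def star_mat_def place_def by simp

text \<open>On columns, \<open>A\<^sup>\<circ> B\<^sup>\<lozenge>\<close> is \<open>A\<close> after \<open>\<sigma>\<close> after \<open>B\<close>, up to the relabelling \<open>\<tau>\<close> of the source.\<close>

lemma act_star:
  "act (star_mat \<alpha> \<beta> \<gamma> s t A B) v = act A (act B (v \<circ> \<tau>') \<circ> \<sigma>)"
proof -
  note rf = row_finite_one_outside[OF A] row_finite_one_outside[OF B]
  let ?C = "\<lambda>m j. B (\<sigma> m) (\<tau> j)"
  have "row_finite ?C" unfolding row_finite_def
  proof
    fix i
    have "finite (\<tau> -` {j. B (\<sigma> i) j \<noteq> 0})"
      using rf(2) by (intro finite_vimageI bij_is_inj[OF bij_\<tau>]) (simp add: row_finite_def)
    then show "finite {j. B (\<sigma> i) (\<tau> j) \<noteq> 0}" by (simp add: vimage_def)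
  qed
  then have "act (star_mat \<alpha> \<beta> \<gamma> s t A B) v = act A (act ?C v)"
    unfolding star_mat_eq by (intro act_imat_mult rf)
  also have "act ?C v = act B (v \<circ> \<tau>') \<circ> \<sigma>"
  proof
    fix m
    show "act ?C v m = (act B (v \<circ> \<tau>') \<circ> \<sigma>) m" unfolding act_def o_apply
      by (rule Sum_any.reindex_cong[OF bij_\<tau>, symmetric])
         (simp add: fun_eq_iff inv_f_f[OF bij_is_inj[OF bij_\<tau>]])
  qed
  finally show ?thesis .
qed

section \<open>Coupling and decoupling of the two factors\<close>

text \<open>As \<open>\<tau>\<close> preserves the decomposition for \<open>\<gamma>\<close> and fixes its middle part, it has no effect on the
  invariants.\<close>

lemma comp_\<tau>_lower: "v \<circ> \<tau> \<in> lower (fst \<gamma>) \<longleftrightarrow> v \<in> lower (fst \<gamma>)"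
  and comp_inv_\<tau>_lower: "v \<circ> \<tau>' \<in> lower (fst \<gamma>) \<longleftrightarrow> v \<in> lower (fst \<gamma>)" for v :: "'k col"
proof -
  have *: "v \<circ> f \<in> lower (fst \<gamma>)"
    if "v \<in> lower (fst \<gamma>)" "bij f" "\<And>i. f i \<le> fst \<gamma> \<longleftrightarrow> i \<le> fst \<gamma>" for v :: "'k col" and f
  proof -
    have "finite (f -` {j. v j \<noteq> 0})"
      using that by (intro finite_vimageI bij_is_inj) (auto simp: lower_def)
    then show ?thesis using that by (auto simp: lower_def vimage_def not_le[symmetric])
  qed
  have inv: "bij (\<tau>')" "\<tau>' i \<le> fst \<gamma> \<longleftrightarrow> i \<le> fst \<gamma>" for i
    using bij_imp_bij_inv[OF bij_\<tau>] \<tau>_le[of "\<tau>' i"] surj_f_inv_f[OF bij_is_surj[OF bij_\<tau>]] by auto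
  have c: "(v \<circ> \<tau>) \<circ> \<tau>' = v" "(v \<circ> \<tau>') \<circ> \<tau> = v"
    using surj_f_inv_f[OF bij_is_surj[OF bij_\<tau>]] inv_f_f[OF bij_is_inj[OF bij_\<tau>]] by auto
  show "v \<circ> \<tau> \<in> lower (fst \<gamma>) \<longleftrightarrow> v \<in> lower (fst \<gamma>)"
    using *[OF _ inv, of "v \<circ> \<tau>"] *[OF _ bij_\<tau> \<tau>_le, of v] unfolding c by blast
  show "v \<circ> \<tau>' \<in> lower (fst \<gamma>) \<longleftrightarrow> v \<in> lower (fst \<gamma>)"
    using *[OF _ inv, of v] *[OF _ bij_\<tau> \<tau>_le, of "v \<circ> \<tau>'"] unfolding c by blast
qed

lemma comp_inv_\<tau>_mids: "w \<in> mids (fst \<gamma>) (snd \<gamma>) \<Longrightarrow> w \<circ> \<tau>' = w" for w :: "'k col"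
proof
  fix i assume w: "w \<in> mids (fst \<gamma>) (snd \<gamma>)"
  have \<tau>: "\<tau> (\<tau>' i) = i" "\<tau>' (\<tau> i) = i"
    using surj_f_inv_f[OF bij_is_surj[OF bij_\<tau>]] inv_f_f[OF bij_is_inj[OF bij_\<tau>]] by auto
  show "(w \<circ> \<tau>') i = w i"
  proof (cases "fst \<gamma> < i \<and> i \<le> snd \<gamma>")
    case True
    then have "\<tau> i = i" using \<tau>_mid by blast
    with \<tau>(2) have "\<tau>' i = i" by simp
    then show ?thesis by simp
  next
    case False
    then have "\<not> (fst \<gamma> < \<tau>' i \<and> \<tau>' i \<le> snd \<gamma>)" using \<tau>(1) \<tau>_mid[of "\<tau>' i"] by auto
    then show ?thesis using False w by (auto simp: mids_def)
  qed
qed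

lemma comp_\<sigma>_\<sigma>: "(v \<circ> \<sigma>) \<circ> \<sigma> = v" for v :: "'k col"
  using \<sigma>_involution by auto

lemma comp_\<sigma>_add: "(v + w) \<circ> \<sigma> = (v \<circ> \<sigma>) + (w \<circ> \<sigma>)" for v w :: "'k col"
  by auto

lemma comp_\<sigma>_mids: "v \<in> mids (fst \<beta>) (snd \<beta>) \<Longrightarrow> v \<circ> \<sigma> = v" for v :: "'k col"
proof
  fix i assume v: "v \<in> mids (fst \<beta>) (snd \<beta>)"
  show "(v \<circ> \<sigma>) i = v i"
  proof (cases "fst \<beta> < i \<and> i \<le> snd \<beta>")
    case True
    then show ?thesis using \<sigma>_mid by auto
  next
    case False
    then have "\<not> (fst \<beta> < \<sigma> i \<and> \<sigma> i \<le> snd \<beta>)" using \<sigma>_le[of i] \<sigma>_gt[of i] by auto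
    then show ?thesis using False v by (auto simp: mids_def)
  qed
qed

lemma finite_support_comp_\<sigma>:
  assumes "finite {j. v j \<noteq> (0 :: 'k)}" shows "finite {j. (v \<circ> \<sigma>) j \<noteq> 0}"
proof -
  have "inj \<sigma>" using \<sigma>_involution by (metis injI)
  from finite_vimageI[OF assms this] show ?thesis by (simp add: vimage_def)
qed

lemma comp_\<sigma>_lower: "v \<in> lower (fst \<beta>) \<Longrightarrow> v \<circ> \<sigma> \<in> lower (fst \<beta>)" for v :: "'k col"
  using finite_support_comp_\<sigma>[of v] \<sigma>_le by (auto simp: lower_def not_le[symmetric])

text \<open>The minus part of the square is moved to places on which \<open>A\<close> and \<open>B\<close> act trivially. This is the
  reason for enlarging the matrices.\<close>

lemma comp_\<sigma>_mids_minus: "v \<in> mids s (fst \<beta>) \<Longrightarrow> v \<circ> \<sigma> \<in> lower s" for v :: "'k col"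
proof -
  assume v: "v \<in> mids s (fst \<beta>)"
  have "(v \<circ> \<sigma>) i = 0" if "s < i" for i
  proof (cases "i \<le> fst \<beta>")
    case True
    then have "\<sigma> i \<le> s" using that \<sigma>_minus by blast
    then show ?thesis using v by (simp add: mids_def)
  next
    case False
    then have "\<not> \<sigma> i \<le> fst \<beta>" using \<sigma>_le by blast
    then show ?thesis using v by (simp add: mids_def)
  qed
  then show ?thesis
    using finite_support_comp_\<sigma>[OF finite_support_mids[OF v]] by (simp add: lower_def)
qed

text \<open>The minus parts \<open>x2\<close>, produced by \<open>B\<close>, and \<open>y1\<close>, required by \<open>A\<close>, need not agree. Their components
  below the square are harmless, because both matrices are the identity there. The component of \<open>y1\<close>
  inside the square is fed in at its image under \<open>\<sigma>\<close>, which \<open>B\<close> does not change and \<open>\<sigma>\<close> then moves back;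
  at the same time \<open>\<sigma>\<close> moves the component of \<open>x2\<close> out of the way, below the square, where it
  ends up in \<open>r\<close>, together with the component of \<open>y1\<close> that was not fed in.\<close>

lemma couple_solutions:
  assumes y1: "y1 \<in> lower (fst \<beta>)" and v: "v \<in> mids (fst \<beta>) (snd \<beta>)"
    and x2: "x2 \<in> lower (fst \<beta>)" and y2: "y2 \<in> lower (fst \<gamma>)" and eq: "act B (y2 + w) = x2 + v"
  obtains y r where "y \<in> lower (fst \<gamma>)" "r \<in> lower s"
    "act A (act B (y + w) \<circ> \<sigma>) = act A (y1 + v) + r"
proof -
  note rfA = row_finite_one_outside[OF A] and rfB = row_finite_one_outside[OF B]
  obtain y1l y1m where y1': "y1l \<in> lower s" "y1m \<in> mids s (fst \<beta>)" "y1 = y1l + y1m"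
    using lower_split[OF y1] .
  obtain x2l x2m where x2': "x2l \<in> lower s" "x2m \<in> mids s (fst \<beta>)" "x2 = x2l + x2m"
    using lower_split[OF x2] .
  \<comment> \<open>The part of \<open>x2\<close> below the square is removed, and the part of \<open>y1\<close> in it is fed in.\<close>
  define y where "y = y2 - x2l + (y1m \<circ> \<sigma>)"
  have low: "y1m \<circ> \<sigma> \<in> lower s" "x2m \<circ> \<sigma> \<in> lower s"
    using comp_\<sigma>_mids_minus y1' x2' by auto
  have "lower s \<subseteq> lower (fst \<gamma>)" by (rule lower_mono[OF s_le(3)])
  then have y: "y \<in> lower (fst \<gamma>)"
    unfolding y_def using y2 x2'(1) low by (intro lower_add lower_diff) auto
  have "act B (y + w) = x2m + v + (y1m \<circ> \<sigma>)"
  proof -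
    have "y + w = (y2 + w) - x2l + (y1m \<circ> \<sigma>)" by (simp add: y_def)
    then have "act B (y + w) = act B (y2 + w) - act B x2l + act B (y1m \<circ> \<sigma>)"
      by (simp only: act_add[OF rfB] act_diff[OF rfB])
    also have "\<dots> = x2 + v - x2l + (y1m \<circ> \<sigma>)"
      by (simp only: act_lower_fixed[OF B x2'(1)] act_lower_fixed[OF B low(1)] eq)
    finally show ?thesis by (simp add: x2'(3))
  qed
  then have "act B (y + w) \<circ> \<sigma> = (x2m \<circ> \<sigma>) + v + y1m"
    by (simp add: comp_\<sigma>_add comp_\<sigma>_\<sigma> comp_\<sigma>_mids[OF v])
  also have "\<dots> = (y1 + v) + ((x2m \<circ> \<sigma>) - y1l)" by (simp add: y1'(3))
  finally have "act A (act B (y + w) \<circ> \<sigma>) = act A (y1 + v) + (act A (x2m \<circ> \<sigma>) - act A y1l)"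
    by (simp only: act_add[OF rfA] act_diff[OF rfA])
  also have "\<dots> = act A (y1 + v) + ((x2m \<circ> \<sigma>) - y1l)"
    by (simp only: act_lower_fixed[OF A low(2)] act_lower_fixed[OF A y1'(1)])
  finally have eq': "act A (act B (y + w) \<circ> \<sigma>) = act A (y1 + v) + ((x2m \<circ> \<sigma>) - y1l)" .
  have "(x2m \<circ> \<sigma>) - y1l \<in> lower s" using low(2) y1'(1) by (rule lower_diff)
  from that[OF y this eq'] show ?thesis .
qed

text \<open>A component of \<open>z\<close> above \<open>\<beta>\<^sub>+\<close> would be moved beyond \<open>t\<close> by \<open>\<sigma>\<close>, where \<open>A\<close> is the identity and cannot
  cancel it.\<close>

lemma decouple_solution:
  assumes z: "z \<in> lower t" and up: "above t (act A (z \<circ> \<sigma>)) = 0"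
  obtains x2 v where "x2 \<in> lower (fst \<beta>)" "v \<in> mids (fst \<beta>) (snd \<beta>)" "z = x2 + v"
    "x2 \<circ> \<sigma> \<in> lower (fst \<beta>)" "z \<circ> \<sigma> = (x2 \<circ> \<sigma>) + v"
proof -
  have zero: "(z \<circ> \<sigma>) i = 0" if "t < i" for i
  proof -
    have "act A (z \<circ> \<sigma>) i = 0" using fun_cong[OF up, of i] that by (simp add: above_def)
    then show ?thesis using act_outside[OF A, of i "z \<circ> \<sigma>"] that by simp
  qed
  have "z j = 0" if "snd \<beta> < j" for j
  proof (cases "j \<le> t")
    case True
    then have "(z \<circ> \<sigma>) (\<sigma> j) = 0" using \<sigma>_plus that zero by blast
    then show ?thesis by (simp add: \<sigma>_involution)
  next
    case False then show ?thesis using z by (simp add: lower_def)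
  qed
  then have "z \<in> lower (snd \<beta>)" using finite_support_lower[OF z] by (simp add: lower_def)
  then obtain x2 v where xv: "x2 \<in> lower (fst \<beta>)" "v \<in> mids (fst \<beta>) (snd \<beta>)" "z = x2 + v"
    by (rule lower_split)
  then show ?thesis using comp_\<sigma>_lower comp_\<sigma>_mids[OF xv(2)] by (intro that[of x2 v]) (auto simp: comp_\<sigma>_add)
qed

lemma act_B_lower_t:
  assumes "v \<in> lower t" shows "act B v \<in> lower t"
proof -
  have "act B v i = 0" if "t < i" for i
    using act_outside[OF B, of i v] assms that by (simp add: lower_def)
  then show ?thesis using finite_support_act[OF B finite_support_lower[OF assms]] by (simp add: lower_def)
qed

end

section \<open>The invariants of the inverse\<close>

lemma lrel_indef_chi_mat_iff:
  "v \<in> lrel_indef (chi_mat \<alpha> \<beta> A) \<longleftrightarrow> v \<in> mids (fst \<alpha>) (snd \<alpha>) \<and>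
    (\<exists>x\<in>lower (fst \<alpha>). \<exists>y\<in>lower (fst \<beta>). act A y = x + v)"
  by (simp add: lrel_indef_def chi_mat_iff mids_0)

text \<open>A vector \<open>v\<close> lies in the domain if some \<open>y\<close> in \<open>lower \<beta>\<^sub>-\<close> compensates the component of \<open>A v\<close> above
  \<open>\<alpha>\<^sub>+\<close>.\<close>

lemma Domain_chi_mat_iff:
  assumes A: "one_outside s t A" and v: "v \<in> mids (fst \<beta>) (snd \<beta>)" and \<alpha>: "\<alpha> \<in> index_pairs"
  shows "v \<in> Domain (chi_mat \<alpha> \<beta> A) \<longleftrightarrow>
    above (snd \<alpha>) (act A v) \<in> (\<lambda>y. above (snd \<alpha>) (act A y)) ` lower (fst \<beta>)"
proof
  note rf = row_finite_one_outside[OF A]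
  interpret f: Vector_Spaces.linear col_scale col_scale "\<lambda>v. above (snd \<alpha>) (act A v)"
    by (rule linear_above_act[OF rf])
  have ab: "fst \<alpha> \<le> snd \<alpha>" using \<alpha> by (simp add: index_pairs_def)
  {
    assume "v \<in> Domain (chi_mat \<alpha> \<beta> A)"
    then obtain u x y where *: "u \<in> mids (fst \<alpha>) (snd \<alpha>)" "x \<in> lower (fst \<alpha>)" "y \<in> lower (fst \<beta>)"
      "act A (y + v) = x + u" by (auto simp: chi_mat_iff)
    have "x + u \<in> lower (snd \<alpha>)" by (rule lower_add_mids[OF *(2,1) ab]) simp
    then have "above (snd \<alpha>) (act A (y + v)) = 0" unfolding *(4) by (rule above_lower)
    then have "above (snd \<alpha>) (act A v) = above (snd \<alpha>) (act A (- y))"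
      by (simp only: f.add f.neg eq_neg_iff_add_eq_0 add.commute)
    moreover have "- y \<in> lower (fst \<beta>)" using *(3) subspace_lower by (rule col.subspace_neg[rotated])
    ultimately show "above (snd \<alpha>) (act A v) \<in> (\<lambda>y. above (snd \<alpha>) (act A y)) ` lower (fst \<beta>)"
      by (rule image_eqI)
  next
    assume "above (snd \<alpha>) (act A v) \<in> (\<lambda>y. above (snd \<alpha>) (act A y)) ` lower (fst \<beta>)"
    then obtain y where y: "y \<in> lower (fst \<beta>)" "above (snd \<alpha>) (act A v) = above (snd \<alpha>) (act A y)"
      by blast
    have y': "- y \<in> lower (fst \<beta>)" using y(1) subspace_lower by (rule col.subspace_neg[rotated])
    have "above (snd \<alpha>) (act A (- y + v)) = 0" using y(2) by (simp only: f.add f.neg) simp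
    moreover have "finite {j. (- y + v) j \<noteq> 0}"
      using finite_support_lower[OF y'] finite_support_mids[OF v] by (rule finite_support_add)
    then have "finite {j. act A (- y + v) j \<noteq> 0}" by (rule finite_support_act[OF A])
    ultimately have "act A (- y + v) \<in> lower (snd \<alpha>)" by (rule above_eq_0_imp_lower)
    then obtain x u where "x \<in> lower (fst \<alpha>)" "u \<in> mids (fst \<alpha>) (snd \<alpha>)" "act A (- y + v) = x + u"
      by (rule lower_split)
    then have "(v, u) \<in> chi_mat \<alpha> \<beta> A" using v y' unfolding chi_mat_iff by blast
    then show "v \<in> Domain (chi_mat \<alpha> \<beta> A)" by blast
  }
qed

text \<open>The indefiniteness is described by a linear map on a finite-dimensional space: the components of
  \<open>y\<close> below \<open>s\<close> only change the minus part of \<open>A y\<close>.\<close>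

lemma lrel_indef_chi_mat:
  assumes A: "one_outside s t A" and \<alpha>: "\<alpha> \<in> index_pairs" and s: "s \<le> fst \<alpha>" "s \<le> fst \<beta>"
  shows "lrel_indef (chi_mat \<alpha> \<beta> A) =
    (\<lambda>y. above (fst \<alpha>) (act A y)) ` {y \<in> mids s (fst \<beta>). above (snd \<alpha>) (act A y) = 0}"
proof (intro equalityI subsetI)
  note rf = row_finite_one_outside[OF A]
  have ab: "fst \<alpha> \<le> snd \<alpha>" using \<alpha> by (simp add: index_pairs_def)
  fix v
  {
    assume "v \<in> lrel_indef (chi_mat \<alpha> \<beta> A)"
    then obtain x y where v: "v \<in> mids (fst \<alpha>) (snd \<alpha>)" and x: "x \<in> lower (fst \<alpha>)"
      and y: "y \<in> lower (fst \<beta>)" and eq: "act A y = x + v" by (auto simp: lrel_indef_chi_mat_iff)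
    obtain l m where lm: "l \<in> lower s" "m \<in> mids s (fst \<beta>)" "y = l + m" using lower_split[OF y] .
    have "act A y = l + act A m" by (simp add: lm(3) act_add[OF rf] act_lower_fixed[OF A lm(1)])
    then have am: "act A m = (x - l) + v" using eq by (simp add: algebra_simps)
    have xl: "x - l \<in> lower (fst \<alpha>)" using x lm(1) lower_mono[OF s(1)] by (intro lower_diff) auto
    have "above (fst \<alpha>) (act A m) = v"
      unfolding am above_add by (simp add: above_lower[OF xl] above_mids[OF v])
    moreover have "(x - l) + v \<in> lower (snd \<alpha>)" by (rule lower_add_mids[OF xl v ab]) simp
    then have "above (snd \<alpha>) (act A m) = 0" unfolding am by (rule above_lower)
    ultimately show "v \<in> (\<lambda>y. above (fst \<alpha>) (act A y)) ` {y \<in> mids s (fst \<beta>). above (snd \<alpha>) (act A y) = 0}"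
      using lm(2) by blast
  next
    assume "v \<in> (\<lambda>y. above (fst \<alpha>) (act A y)) ` {y \<in> mids s (fst \<beta>). above (snd \<alpha>) (act A y) = 0}"
    then obtain y where y: "y \<in> mids s (fst \<beta>)" "above (snd \<alpha>) (act A y) = 0"
      and v: "v = above (fst \<alpha>) (act A y)" by blast
    have "act A y \<in> lower (snd \<alpha>)"
      by (rule above_eq_0_imp_lower[OF y(2) finite_support_act[OF A finite_support_mids[OF y(1)]]])
    then obtain x u where xu: "x \<in> lower (fst \<alpha>)" "u \<in> mids (fst \<alpha>) (snd \<alpha>)" "act A y = x + u"
      by (rule lower_split)
    have "v = u" unfolding v xu(3) above_add by (simp add: above_lower[OF xu(1)] above_mids[OF xu(2)])
    moreover have "y \<in> lower (fst \<beta>)" using y(1) mids_subset_lower by blast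
    ultimately show "v \<in> lrel_indef (chi_mat \<alpha> \<beta> A)" using xu by (auto simp: lrel_indef_chi_mat_iff)
  }
qed

lemma subspace_lrel_indef:
  assumes "one_outside s t A" and "\<alpha> \<in> index_pairs" and "s \<le> fst \<alpha>" "s \<le> fst \<beta>"
  shows "col.subspace (lrel_indef (chi_mat \<alpha> \<beta> A))"
proof -
  note rf = row_finite_one_outside[OF assms(1)]
  have "{y \<in> mids s (fst \<beta>). above (snd \<alpha>) (act A y) = 0}
      = {y \<in> mids s (fst \<beta>). above (snd \<alpha>) (act A y) \<in> {0}}" by simp
  then have "col.subspace {y \<in> mids s (fst \<beta>). above (snd \<alpha>) (act A y) = 0}"
    using subspace_preimage[OF linear_above_act[OF rf] subspace_mids col.subspace_single_0] by simp
  then show ?thesis unfolding lrel_indef_chi_mat[OF assms]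
    by (rule subspace_image[OF linear_above_act[OF rf]])
qed

lemma fin_dim_lrel_indef: "fin_dim (lrel_indef (chi_mat \<alpha> \<beta> A))"
  by (rule fin_dim_subset[OF fin_dim_mids]) (auto simp: lrel_indef_chi_mat_iff)

text \<open>Split \<open>A y\<close>, for \<open>y\<close> in the finite part of the minus space, into its plus, middle and minus parts.
  The plus part has rank \<open>\<eta>(A)\<close>; on its kernel the middle part ranges over the indefiniteness; what
  remains are the \<open>y\<close> with \<open>A y\<close> in the minus space. Hence rank-nullity, used twice, gives the sum.\<close>

lemma eta_mat_plus_indef:
  assumes A: "one_outside s t A" and \<alpha>: "\<alpha> \<in> index_pairs" and s: "s \<le> fst \<alpha>" "s \<le> fst \<beta>"
  shows "eta_mat \<alpha> \<beta> A + col.dim (lrel_indef (chi_mat \<alpha> \<beta> A))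
      + col.dim {y \<in> mids s (fst \<beta>). act A y \<in> lower (fst \<alpha>)} = nat (fst \<beta> - s)"
proof -
  note rf = row_finite_one_outside[OF A]
  have ab: "fst \<alpha> \<le> snd \<alpha>" using \<alpha> by (simp add: index_pairs_def)
  let ?V = "mids s (fst \<beta>) :: 'a col set"
  let ?f = "\<lambda>y. above (snd \<alpha>) (act A y)" and ?g = "\<lambda>y. above (fst \<alpha>) (act A y)"
  let ?N = "{y \<in> ?V. ?f y = 0}"
  note lin = linear_above_act[OF rf]
  have "?N = {y \<in> ?V. ?f y \<in> {0}}" by simp
  then have N: "col.subspace ?N"
    using subspace_preimage[OF lin subspace_mids col.subspace_single_0] by simp
  have fN: "fin_dim ?N" by (rule fin_dim_subset[OF fin_dim_mids]) auto
  have "?f ` lower (fst \<beta>) = ?f ` ?V"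
  proof (intro equalityI subsetI)
    fix v assume "v \<in> ?f ` lower (fst \<beta>)"
    then obtain y where y: "y \<in> lower (fst \<beta>)" "v = ?f y" by blast
    obtain l m where lm: "l \<in> lower s" "m \<in> ?V" "y = l + m" using lower_split[OF y(1)] .
    have "l \<in> lower (snd \<alpha>)" using lm(1) lower_mono[of s "snd \<alpha>"] s ab by auto
    then have "v = ?f m"
      by (simp add: y(2) lm(3) act_add[OF rf] act_lower_fixed[OF A lm(1)] above_add above_lower)
    then show "v \<in> ?f ` ?V" using lm(2) by blast
  next
    fix v assume "v \<in> ?f ` ?V"
    then show "v \<in> ?f ` lower (fst \<beta>)" using mids_subset_lower by blast
  qed
  then have "eta_mat \<alpha> \<beta> A + col.dim ?N = nat (fst \<beta> - s)"
    using rank_nullity[OF lin subspace_mids fin_dim_mids, of "snd \<alpha>" s "fst \<beta>"]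
    by (simp add: eta_mat_eq_dim(1)[OF A] dim_mids)
  moreover have "{y \<in> ?N. ?g y = 0} = {y \<in> ?V. act A y \<in> lower (fst \<alpha>)}"
  proof (intro equalityI subsetI)
    fix y assume "y \<in> {y \<in> ?N. ?g y = 0}"
    then have y: "y \<in> ?V" "?g y = 0" by auto
    from above_eq_0_imp_lower[OF y(2) finite_support_act[OF A finite_support_mids[OF y(1)]]] y(1)
    show "y \<in> {y \<in> ?V. act A y \<in> lower (fst \<alpha>)}" by simp
  next
    fix y assume "y \<in> {y \<in> ?V. act A y \<in> lower (fst \<alpha>)}"
    then have y: "y \<in> ?V" "act A y \<in> lower (fst \<alpha>)" "act A y \<in> lower (snd \<alpha>)"
      using lower_mono[OF ab] by auto
    then show "y \<in> {y \<in> ?N. ?g y = 0}" by (simp add: above_lower)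
  qed
  ultimately show ?thesis
    using rank_nullity[OF lin N fN, of "fst \<alpha>"] unfolding lrel_indef_chi_mat[OF assms] by simp
qed

lemma chi_mat_inverse:
  assumes A: "A \<in> carrier GL"
  shows "chi_mat \<beta> \<alpha> (inv\<^bsub>GL\<^esub> A) = (chi_mat \<alpha> \<beta> A)\<inverse>"
proof -
  have "act (inv\<^bsub>GL\<^esub> A) v = w \<longleftrightarrow> act A w = v" for v w
    using act_inv_GL[OF A] by metis
  then show ?thesis by (auto simp: chi_mat_iff) metis+
qed

text \<open>Apply the previous lemma to \<open>A\<close> and to \<open>A\<inverse>\<close>. The third summands agree, since \<open>A\<close> maps one of the
  spaces onto the other, and the indefiniteness of the transposed relation is the kernel.\<close>

lemma eta_mat_inverse:
  assumes A: "A \<in> carrier GL" and \<alpha>: "\<alpha> \<in> index_pairs" and \<beta>: "\<beta> \<in> index_pairs"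
  shows "int (eta_mat \<beta> \<alpha> (inv\<^bsub>GL\<^esub> A)) = int (eta_mat \<alpha> \<beta> A)
    + int (col.dim (lrel_indef (chi_mat \<alpha> \<beta> A))) - int (col.dim (lrel_ker (chi_mat \<alpha> \<beta> A)))
    - fst \<beta> + fst \<alpha>"
proof -
  interpret group "GL :: 'a imat monoid" by (rule group_GL)
  let ?A' = "inv\<^bsub>GL\<^esub> A"
  obtain s1 t1 where st1: "one_outside s1 t1 A" using GL_one_outside[OF A] .
  obtain s2 t2 where st2: "one_outside s2 t2 ?A'" using GL_one_outside[OF inv_closed[OF A]] .
  define s where "s = min (min s1 s2) (min (fst \<alpha>) (fst \<beta>))"
  define t where "t = max t1 t2"
  have st: "one_outside s t A" "one_outside s t ?A'"
    by (rule one_outside_mono[OF st1], simp_all add: s_def t_def)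
       (rule one_outside_mono[OF st2], simp_all add: s_def t_def)
  have s: "s \<le> fst \<alpha>" "s \<le> fst \<beta>" by (simp_all add: s_def)
  let ?Y = "{y \<in> mids s (fst \<beta>). act A y \<in> lower (fst \<alpha>)}"
  let ?Y' = "{x \<in> mids s (fst \<alpha>). act ?A' x \<in> lower (fst \<beta>)}"
  have below: "act A v i = v i" "act ?A' v i = v i" if "i \<le> s" for v i
    using that by (auto intro!: act_outside[OF st(1)] act_outside[OF st(2)])
  have Y': "?Y' = act A ` ?Y"
  proof (intro equalityI subsetI)
    fix x assume x: "x \<in> ?Y'"
    then have x0: "x i = 0" if "i \<le> s" for i using that by (simp add: mids_def)
    have "act ?A' x \<in> mids s (fst \<beta>)"
      using x below(2) x0 by (intro lower_imp_mids) auto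
    moreover have "act A (act ?A' x) \<in> lower (fst \<alpha>)"
      using x mids_subset_lower by (auto simp: act_inv_GL(2)[OF A])
    ultimately have "act ?A' x \<in> ?Y" by simp
    then show "x \<in> act A ` ?Y" by (rule image_eqI[rotated]) (simp only: act_inv_GL(2)[OF A])
  next
    fix x assume "x \<in> act A ` ?Y"
    then obtain y where y: "y \<in> ?Y" "x = act A y" by blast
    then have y0: "y i = 0" if "i \<le> s" for i using that by (simp add: mids_def)
    have "x \<in> mids s (fst \<alpha>)"
      unfolding y(2) using y(1) below(1) y0 by (intro lower_imp_mids) auto
    moreover have "act ?A' x \<in> lower (fst \<beta>)"
      using y mids_subset_lower by (auto simp: act_inv_GL(1)[OF A])
    ultimately show "x \<in> ?Y'" by simp
  qed
  have rf: "row_finite A" by (rule GL_row_finite[OF A])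
  have "col.subspace ?Y" by (rule subspace_preimage[OF linear_act[OF rf] subspace_mids subspace_lower])
  moreover have "fin_dim ?Y" by (rule fin_dim_subset[OF fin_dim_mids]) auto
  moreover have "v = 0" if "act A v = 0" for v
  proof -
    have "act ?A' (0 :: 'a col) = 0"
      using act_diff[OF row_finite_one_outside[OF st(2)], of 0 0] by simp
    then show ?thesis using act_inv_GL(1)[OF A, of v] that by simp
  qed
  ultimately have dim_Y: "col.dim ?Y' = col.dim ?Y"
    unfolding Y' by (intro dim_image_inj[OF linear_act[OF rf]])
  have ker: "lrel_indef (chi_mat \<beta> \<alpha> ?A') = lrel_ker (chi_mat \<alpha> \<beta> A)"
    by (simp add: chi_mat_inverse[OF A] lrel_indef_def lrel_ker_def)
  show ?thesis
    using eta_mat_plus_indef[OF st(1) \<alpha> s] eta_mat_plus_indef[OF st(2) \<beta> s(2,1)] s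
    unfolding dim_Y ker by linarith
qed

section \<open>The invariants of the product\<close>

context star_choice_data
begin

lemma act_star_eq:
  assumes w: "w \<in> mids (fst \<gamma>) (snd \<gamma>)"
  shows "act (star_mat \<alpha> \<beta> \<gamma> s t A B) (y + w) = act A (act B ((y \<circ> \<tau>') + w) \<circ> \<sigma>)"
proof -
  have "(y + w) \<circ> \<tau>' = (y \<circ> \<tau>') + (w \<circ> \<tau>')" by auto
  then show ?thesis by (simp only: act_star comp_inv_\<tau>_mids[OF w])
qed

lemma comp_\<tau>_inverse: "(y \<circ> \<tau>) \<circ> \<tau>' = y" for y :: "'k col"
  using surj_f_inv_f[OF bij_is_surj[OF bij_\<tau>]] by auto

text \<open>From a solution for the product, \<open>decouple_solution\<close> reads off the intermediate vector; conversely
  \<open>couple_solutions\<close> combines solutions for the factors.\<close>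

lemma chi_mat_star:
  "chi_mat \<alpha> \<gamma> (star_mat \<alpha> \<beta> \<gamma> s t A B) = chi_mat \<beta> \<gamma> B O chi_mat \<alpha> \<beta> A"
proof (intro equalityI subsetI; clarify)
  fix w u assume "(w, u) \<in> chi_mat \<alpha> \<gamma> (star_mat \<alpha> \<beta> \<gamma> s t A B)"
  then obtain x y where w: "w \<in> mids (fst \<gamma>) (snd \<gamma>)" and u: "u \<in> mids (fst \<alpha>) (snd \<alpha>)"
    and x: "x \<in> lower (fst \<alpha>)" and "y \<in> lower (fst \<gamma>)"
    and "act (star_mat \<alpha> \<beta> \<gamma> s t A B) (y + w) = x + u"
    by (auto simp: chi_mat_iff)
  then obtain y where y: "y \<in> lower (fst \<gamma>)" and eq: "act A (act B (y + w) \<circ> \<sigma>) = x + u"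
    using comp_inv_\<tau>_lower by (metis act_star_eq)
  have "y + w \<in> lower t"
    by (rule lower_add_mids[OF y w]) (use t_ge le in auto)
  then have z: "act B (y + w) \<in> lower t" by (rule act_B_lower_t)
  have "x + u \<in> lower t"
    by (rule lower_add_mids[OF x u]) (use t_ge le in auto)
  then have "above t (act A (act B (y + w) \<circ> \<sigma>)) = 0" unfolding eq by (rule above_lower)
  then obtain x2 v where *: "x2 \<in> lower (fst \<beta>)" "v \<in> mids (fst \<beta>) (snd \<beta>)" "act B (y + w) = x2 + v"
    "x2 \<circ> \<sigma> \<in> lower (fst \<beta>)" "act B (y + w) \<circ> \<sigma> = (x2 \<circ> \<sigma>) + v"
    using decouple_solution[OF z] by blast
  have "(w, v) \<in> chi_mat \<beta> \<gamma> B" using * w y by (auto simp: chi_mat_iff)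
  moreover have "(v, u) \<in> chi_mat \<alpha> \<beta> A" using *(2,4) u x eq unfolding *(5) by (auto simp: chi_mat_iff)
  ultimately show "(w, u) \<in> chi_mat \<beta> \<gamma> B O chi_mat \<alpha> \<beta> A" by blast
next
  fix w v u assume "(w, v) \<in> chi_mat \<beta> \<gamma> B" "(v, u) \<in> chi_mat \<alpha> \<beta> A"
  then obtain x1 y1 x2 y2 where w: "w \<in> mids (fst \<gamma>) (snd \<gamma>)" and v: "v \<in> mids (fst \<beta>) (snd \<beta>)"
    and u: "u \<in> mids (fst \<alpha>) (snd \<alpha>)" and x1: "x1 \<in> lower (fst \<alpha>)" and y1: "y1 \<in> lower (fst \<beta>)"
    and x2: "x2 \<in> lower (fst \<beta>)" and y2: "y2 \<in> lower (fst \<gamma>)"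
    and eqA: "act A (y1 + v) = x1 + u" and eqB: "act B (y2 + w) = x2 + v"
    by (auto simp: chi_mat_iff)
  obtain y r where y: "y \<in> lower (fst \<gamma>)" and r: "r \<in> lower s"
    and eq: "act A (act B (y + w) \<circ> \<sigma>) = act A (y1 + v) + r"
    using couple_solutions[OF y1 v x2 y2 eqB] .
  have "act (star_mat \<alpha> \<beta> \<gamma> s t A B) ((y \<circ> \<tau>) + w) = (x1 + r) + u"
    unfolding act_star_eq[OF w] comp_\<tau>_inverse eq eqA by (simp add: algebra_simps)
  moreover have "y \<circ> \<tau> \<in> lower (fst \<gamma>)" using y by (simp add: comp_\<tau>_lower)
  moreover have "x1 + r \<in> lower (fst \<alpha>)" using x1 r lower_mono[OF s_le(1)] by (intro lower_add) auto
  ultimately show "(w, u) \<in> chi_mat \<alpha> \<gamma> (star_mat \<alpha> \<beta> \<gamma> s t A B)"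
    using w u by (auto simp: chi_mat_iff)
qed

text \<open>Let \<open>E\<close> be the space whose dimension is \<open>\<eta>\<close> of the product, and project it to the places beyond \<open>t\<close>.
  There only the plus part of \<open>B y\<close> is visible, which \<open>\<sigma>\<close> has moved there; so the image has
  dimension \<open>\<eta>(B)\<close>. The kernel consists of the vectors obtained from \<open>B y\<close> without plus part: their middle
  part ranges over the indefiniteness \<open>I\<close> of \<open>\<chi>(B)\<close>, and the minus part handed to \<open>A\<close> is
  arbitrary. So the kernel is the sum of the image of \<open>a\<^sub>3\<^sub>1\<close>, of dimension \<open>\<eta>(A)\<close>, and of the image
  of \<open>I\<close>, and a vector of \<open>I\<close> contributes nothing new precisely if it is in the domain of \<open>\<chi>(A)\<close>.\<close>

lemma eta_mat_star:
  "eta_mat \<alpha> \<gamma> (star_mat \<alpha> \<beta> \<gamma> s t A B) = eta_mat \<alpha> \<beta> A + eta_mat \<beta> \<gamma> B +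
    quot_dim (lrel_indef (chi_mat \<beta> \<gamma> B)) (lrel_indef (chi_mat \<beta> \<gamma> B) \<inter> Domain (chi_mat \<alpha> \<beta> A))"
proof -
  note rfA = row_finite_one_outside[OF A] and rfS = row_finite_one_outside[OF one_outside_star]
  let ?f = "\<lambda>v. above (snd \<alpha>) (act A v)"
  let ?b = "\<lambda>y. above (snd \<beta>) (act B y)"
  let ?S = "star_mat \<alpha> \<beta> \<gamma> s t A B"
  define E where "E = (\<lambda>y. above (snd \<alpha>) (act ?S y)) ` lower (fst \<gamma>)"
  define W where "W = ?f ` lower (fst \<beta>)"
  define I where "I = lrel_indef (chi_mat \<beta> \<gamma> B)"
  note linA = linear_above_act[OF rfA]
  have E_eq: "E = (\<lambda>y. ?f (act B y \<circ> \<sigma>)) ` lower (fst \<gamma>)"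
  proof (intro equalityI subsetI)
    fix e assume "e \<in> E"
    then show "e \<in> (\<lambda>y. ?f (act B y \<circ> \<sigma>)) ` lower (fst \<gamma>)"
      using comp_inv_\<tau>_lower by (auto simp: E_def act_star)
  next
    fix e assume "e \<in> (\<lambda>y. ?f (act B y \<circ> \<sigma>)) ` lower (fst \<gamma>)"
    then obtain y where y: "y \<in> lower (fst \<gamma>)" "e = ?f (act B y \<circ> \<sigma>)" by blast
    then have "e = above (snd \<alpha>) (act ?S (y \<circ> \<tau>))" "y \<circ> \<tau> \<in> lower (fst \<gamma>)"
      by (simp_all only: act_star comp_\<tau>_inverse comp_\<tau>_lower)
    then show "e \<in> E" unfolding E_def by blast
  qed
  have E: "col.subspace E" "fin_dim E"
    unfolding E_def using subspace_image[OF linear_above_act[OF rfS] subspace_lower]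
      eta_mat_eq_dim(2)[OF one_outside_star] by auto
  have W: "col.subspace W" "fin_dim W" "col.dim W = eta_mat \<alpha> \<beta> A"
    unfolding W_def using subspace_image[OF linA subspace_lower]
      eta_mat_eq_dim[OF A] by auto
  have I: "col.subspace I" "fin_dim I" "I \<subseteq> mids (fst \<beta>) (snd \<beta>)"
    unfolding I_def
    by (rule subspace_lrel_indef[OF B \<beta> s_le(2,3)], rule fin_dim_lrel_indef)
       (auto simp: lrel_indef_chi_mat_iff)
  have Blow: "act B y \<in> lower t" if "y \<in> lower (fst \<gamma>)" for y
    using that lower_mono[of "fst \<gamma>" t] t_ge le by (intro act_B_lower_t) auto
  have top: "above t (?f (act B y \<circ> \<sigma>)) = ?b y \<circ> \<sigma>" if y: "y \<in> lower (fst \<gamma>)" for y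
  proof
    fix i
    let ?z = "act B y"
    have z: "?z j = 0" if "t < j" for j using Blow[OF y] that by (simp add: lower_def)
    show "above t (?f (?z \<circ> \<sigma>)) i = (?b y \<circ> \<sigma>) i"
    proof (cases "t < i")
      case True
      then have "above t (?f (?z \<circ> \<sigma>)) i = ?z (\<sigma> i)"
        using t_ge act_outside[OF A, of i "?z \<circ> \<sigma>"] by (simp add: above_def)
      also have "\<dots> = ?b y (\<sigma> i)" using True t_ge \<sigma>_gt[of i] by (simp add: above_def)
      finally show ?thesis by simp
    next
      case False
      have "?b y (\<sigma> i) = 0"
      proof (cases "snd \<beta> < i")
        case True
        then have "t < \<sigma> i" using False \<sigma>_plus by simp
        then show ?thesis using z by (simp add: above_def)
      next
        case False
        then show ?thesis using \<sigma>_gt[of i] by (simp add: above_def)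
      qed
      then show ?thesis using False by (simp add: above_def)
    qed
  qed
  have dim_top: "col.dim (above t ` E) = eta_mat \<beta> \<gamma> B"
  proof -
    let ?EB = "?b ` lower (fst \<gamma>)"
    have "above t ` E = (\<lambda>z. z \<circ> \<sigma>) ` ?EB" unfolding E_eq image_image using top by (intro image_cong refl)
    moreover have lin: "Vector_Spaces.linear col_scale col_scale (\<lambda>z :: 'k col. z \<circ> \<sigma>)"
      unfolding Vector_Spaces.linear_iff by (auto simp: fun_eq_iff col_scale_def col.vector_space_axioms)
    moreover have "col.dim ((\<lambda>z. z \<circ> \<sigma>) ` ?EB) = col.dim ?EB"
    proof (rule dim_image_inj[OF lin])
      show "col.subspace ?EB"
        by (rule subspace_image[OF linear_above_act[OF row_finite_one_outside[OF B]] subspace_lower])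
      show "fin_dim ?EB" by (rule eta_mat_eq_dim(2)[OF B])
      fix z :: "'k col" assume "z \<circ> \<sigma> = 0"
      then have "(z \<circ> \<sigma>) \<circ> \<sigma> = 0" by (simp add: fun_eq_iff)
      then show "z = 0" by (simp only: comp_\<sigma>_\<sigma>)
    qed
    ultimately show ?thesis by (simp add: eta_mat_eq_dim(1)[OF B])
  qed
  have kernel: "{e \<in> E. above t e = 0} = {w + v |w v. w \<in> W \<and> v \<in> ?f ` I}"
  proof (intro equalityI subsetI)
    fix e assume "e \<in> {e \<in> E. above t e = 0}"
    then obtain y where y: "y \<in> lower (fst \<gamma>)" and e: "e = ?f (act B y \<circ> \<sigma>)" "above t e = 0"
      unfolding E_eq by blast
    have "above t (act A (act B y \<circ> \<sigma>)) = 0" using e t_ge by (simp add: above_comp_above)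
    then obtain x2 v where *: "x2 \<in> lower (fst \<beta>)" "v \<in> mids (fst \<beta>) (snd \<beta>)" "act B y = x2 + v"
      "x2 \<circ> \<sigma> \<in> lower (fst \<beta>)" "act B y \<circ> \<sigma> = (x2 \<circ> \<sigma>) + v"
      using decouple_solution[OF Blow[OF y]] by blast
    have "v \<in> I" using * y by (auto simp: I_def lrel_indef_chi_mat_iff)
    moreover have "e = ?f (x2 \<circ> \<sigma>) + ?f v" unfolding e(1) *(5) act_add[OF rfA] above_add ..
    ultimately show "e \<in> {w + v |w v. w \<in> W \<and> v \<in> ?f ` I}" using *(4) unfolding W_def by blast
  next
    fix e assume "e \<in> {w + v |w v. w \<in> W \<and> v \<in> ?f ` I}"
    then obtain y1 v where y1: "y1 \<in> lower (fst \<beta>)" and v: "v \<in> I" and e: "e = ?f y1 + ?f v"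
      unfolding W_def by blast
    obtain x2 y2 where x2: "x2 \<in> lower (fst \<beta>)" and y2: "y2 \<in> lower (fst \<gamma>)" and eqB: "act B (y2 + 0) = x2 + v"
      using v by (auto simp: I_def lrel_indef_chi_mat_iff)
    have vm: "v \<in> mids (fst \<beta>) (snd \<beta>)" using v I(3) by blast
    obtain y r where y: "y \<in> lower (fst \<gamma>)" and r: "r \<in> lower s"
      and eq: "act A (act B (y + 0) \<circ> \<sigma>) = act A (y1 + v) + r"
      using couple_solutions[OF y1 vm x2 y2 eqB] .
    have "r \<in> lower (snd \<alpha>)" using r lower_mono[of s "snd \<alpha>"] s_le le by auto
    then have "?f (act B y \<circ> \<sigma>) = e"
      using eq by (simp add: above_add above_lower e act_add[OF rfA])
    then have "e \<in> E" using y unfolding E_eq by blast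
    moreover have "act A (y1 + v) \<in> lower t"
    proof -
      have "y1 + v \<in> lower t"
        by (rule lower_add_mids[OF y1 vm]) (use t_ge le in auto)
      then show ?thesis
        using act_lower[OF A, of t] one_outsideD[OF A] by (auto simp: imat_one_def)
    qed
    then have "above t e = 0"
      using t_ge by (simp add: e above_add[symmetric] act_add[OF rfA, symmetric] above_comp_above above_lower)
    ultimately show "e \<in> {e \<in> E. above t e = 0}" by blast
  qed
  have D: "{v \<in> I. ?f v \<in> W} = I \<inter> Domain (chi_mat \<alpha> \<beta> A)"
    using I(3) Domain_chi_mat_iff[OF A _ \<alpha>] unfolding W_def by blast
  have "col.dim I = col.dim (I \<inter> Domain (chi_mat \<alpha> \<beta> A)) + quot_dim I (I \<inter> Domain (chi_mat \<alpha> \<beta> A))"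
    unfolding D[symmetric]
    by (rule quot_dim_eq[OF I(1) subspace_preimage[OF linA I(1) W(1)] _ I(2)]) blast
  moreover have "col.dim {e \<in> E. above t e = 0} + col.dim (I \<inter> Domain (chi_mat \<alpha> \<beta> A)) = col.dim W + col.dim I"
    unfolding kernel D[symmetric] by (rule dim_sum_image[OF linA I(1) W(1) I(2) W(2)])
  moreover have "col.dim (above t ` E) + col.dim {e \<in> E. above t e = 0} = col.dim E"
    by (rule rank_nullity[OF linear_above E])
  moreover have "eta_mat \<alpha> \<gamma> ?S = col.dim E"
    unfolding E_def by (rule eta_mat_eq_dim(1)[OF one_outside_star])
  ultimately show ?thesis using dim_top W(3) by (simp add: I_def)
qed

end

section \<open>The invariants of double cosets\<close>

text \<open>Two matrices in GL deviate from the identity in a common square, so the choice in the definition of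
  the product is made from a nonempty set.\<close>

lemma star_representatives:
  assumes \<alpha>: "\<alpha> \<in> index_pairs" and \<beta>: "\<beta> \<in> index_pairs" and \<gamma>: "\<gamma> \<in> index_pairs"
    and \<aa>: "\<aa> \<in> dcosets \<alpha> \<beta>" and \<bb>: "\<bb> \<in> dcosets \<beta> \<gamma>"
  obtains s t A B where "star_choice \<alpha> \<beta> \<gamma> \<aa> \<bb> s t A B"
    "star \<alpha> \<beta> \<gamma> \<aa> \<bb> = dcoset \<alpha> \<gamma> (star_mat \<alpha> \<beta> \<gamma> s t A B)"
proof -
  obtain A B where A: "A \<in> carrier GL" "\<aa> = dcoset \<alpha> \<beta> A" and B: "B \<in> carrier GL" "\<bb> = dcoset \<beta> \<gamma> B"
    using \<aa> \<bb> by (auto simp: dcosets_def)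
  obtain s1 t1 where st1: "one_outside s1 t1 A" using GL_one_outside[OF A(1)] .
  obtain s2 t2 where st2: "one_outside s2 t2 B" using GL_one_outside[OF B(1)] .
  define s where "s = Min {s1, s2, fst \<alpha>, fst \<beta>, fst \<gamma>}"
  define t where "t = Max {t1, t2, snd \<alpha>, snd \<beta>, snd \<gamma>}"
  have "A \<in> carrier finitary_monoid" "B \<in> carrier finitary_monoid"
    using st1 st2 finitary_iff_one_outside by blast+
  then have "A \<in> \<aa>" "B \<in> \<bb>"
    unfolding A(2) B(2) by (auto intro: dcoset_refl \<alpha> \<beta> \<gamma>)
  moreover have "one_outside s t A" by (rule one_outside_mono[OF st1]) (simp_all add: s_def t_def)
  moreover have "one_outside s t B" by (rule one_outside_mono[OF st2]) (simp_all add: s_def t_def)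
  ultimately have "star_choice \<alpha> \<beta> \<gamma> \<aa> \<bb> s t A B"
    unfolding star_choice_def
    by (simp add: s_def t_def min_le_iff_disj le_max_iff_disj)
  then have ex: "\<exists>q. case q of (s, t, A, B) \<Rightarrow> star_choice \<alpha> \<beta> \<gamma> \<aa> \<bb> s t A B"
    by (intro exI[of _ "(s, t, A, B)"]) simp
  obtain s' t' A' B' where q: "(SOME (s, t, A, B). star_choice \<alpha> \<beta> \<gamma> \<aa> \<bb> s t A B) = (s', t', A', B')"
    by (rule prod_cases4)
  from someI_ex[OF ex] have "star_choice \<alpha> \<beta> \<gamma> \<aa> \<bb> s' t' A' B'" unfolding q by simp
  moreover have "star \<alpha> \<beta> \<gamma> \<aa> \<bb> = dcoset \<alpha> \<gamma> (star_mat \<alpha> \<beta> \<gamma> s' t' A' B')"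
    unfolding star_def q by simp
  ultimately show ?thesis by (rule that)
qed

theorem theorem1p6:
  fixes \<alpha> \<beta> \<gamma> :: "int \<times> int" and \<aa> \<bb> :: "'k::field imat set"
  assumes "\<alpha> \<in> index_pairs" and "\<beta> \<in> index_pairs" and "\<gamma> \<in> index_pairs"
    and "\<aa> \<in> dcosets \<alpha> \<beta>" and "\<bb> \<in> dcosets \<beta> \<gamma>"
  shows "chi \<alpha> \<gamma> (star \<alpha> \<beta> \<gamma> \<aa> \<bb>) = lrel_prod (chi \<alpha> \<beta> \<aa>) (chi \<beta> \<gamma> \<bb>) \<and>
         eta \<alpha> \<gamma> (star \<alpha> \<beta> \<gamma> \<aa> \<bb>) =
           eta \<alpha> \<beta> \<aa> + eta \<beta> \<gamma> \<bb> +
           quot_dim (lrel_indef (chi \<beta> \<gamma> \<bb>))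
             (lrel_indef (chi \<beta> \<gamma> \<bb>) \<inter> Domain (chi \<alpha> \<beta> \<aa>)) \<and>
         chi \<beta> \<alpha> (star_inv \<alpha> \<beta> \<aa>) = (chi \<alpha> \<beta> \<aa>)\<inverse> \<and>
         int (eta \<beta> \<alpha> (star_inv \<alpha> \<beta> \<aa>)) =
           int (eta \<alpha> \<beta> \<aa>) + int (col.dim (lrel_indef (chi \<alpha> \<beta> \<aa>)))
             - int (col.dim (lrel_ker (chi \<alpha> \<beta> \<aa>))) - fst \<beta> + fst \<alpha>"
proof -
  interpret group "GL :: 'k imat monoid" by (rule group_GL)
  have GL_finitary: "A \<in> carrier finitary_monoid" if "A \<in> carrier GL" for A :: "'k imat"
    using that by (auto simp: GL_def units_of_def Units_def)
  obtain A0 B0 where A0: "A0 \<in> carrier GL" "\<aa> = dcoset \<alpha> \<beta> A0"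
    and B0: "B0 \<in> carrier GL" "\<bb> = dcoset \<beta> \<gamma> B0"
    using assms(4,5) by (auto simp: dcosets_def)
  obtain s t A B where sc: "star_choice \<alpha> \<beta> \<gamma> \<aa> \<bb> s t A B"
    and star: "star \<alpha> \<beta> \<gamma> \<aa> \<bb> = dcoset \<alpha> \<gamma> (star_mat \<alpha> \<beta> \<gamma> s t A B)"
    using star_representatives[OF assms] .
  interpret S: star_choice_data \<alpha> \<beta> \<gamma> s t A B
    using sc assms(1-3) by (simp add: star_choice_data_def star_choice_def)
  have a: "chi \<alpha> \<beta> \<aa> = chi_mat \<alpha> \<beta> A" "eta \<alpha> \<beta> \<aa> = eta_mat \<alpha> \<beta> A"
    and b: "chi \<beta> \<gamma> \<bb> = chi_mat \<beta> \<gamma> B" "eta \<beta> \<gamma> \<bb> = eta_mat \<beta> \<gamma> B"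
    using sc chi_dcoset[OF assms(1,2) GL_finitary[OF A0(1)]] eta_dcoset[OF assms(1,2) GL_finitary[OF A0(1)]]
      chi_dcoset[OF assms(2,3) GL_finitary[OF B0(1)]] eta_dcoset[OF assms(2,3) GL_finitary[OF B0(1)]]
      invariants_dcoset[OF assms(1,2) GL_finitary[OF A0(1)], of A]
      invariants_dcoset[OF assms(2,3) GL_finitary[OF B0(1)], of B]
    by (simp_all add: star_choice_def A0(2) B0(2))
  have "star_mat \<alpha> \<beta> \<gamma> s t A B \<in> carrier finitary_monoid"
    using S.one_outside_star finitary_iff_one_outside by blast
  from chi_dcoset[OF assms(1,3) this] eta_dcoset[OF assms(1,3) this]
  have ab: "chi \<alpha> \<gamma> (star \<alpha> \<beta> \<gamma> \<aa> \<bb>) = chi_mat \<alpha> \<gamma> (star_mat \<alpha> \<beta> \<gamma> s t A B)"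
    "eta \<alpha> \<gamma> (star \<alpha> \<beta> \<gamma> \<aa> \<bb>) = eta_mat \<alpha> \<gamma> (star_mat \<alpha> \<beta> \<gamma> s t A B)"
    by (simp_all add: star)
  have a0: "chi \<alpha> \<beta> \<aa> = chi_mat \<alpha> \<beta> A0" "eta \<alpha> \<beta> \<aa> = eta_mat \<alpha> \<beta> A0"
    using chi_dcoset[OF assms(1,2) GL_finitary[OF A0(1)]] eta_dcoset[OF assms(1,2) GL_finitary[OF A0(1)]]
    by (simp_all add: A0(2))
  have inv: "star_inv \<alpha> \<beta> \<aa> = dcoset \<beta> \<alpha> (inv\<^bsub>GL\<^esub> A0)"
    unfolding A0(2) by (rule star_inv_dcoset[OF assms(1,2) A0(1)])
  note fi = GL_finitary[OF inv_closed[OF A0(1)]]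
  have "chi \<alpha> \<gamma> (star \<alpha> \<beta> \<gamma> \<aa> \<bb>) = lrel_prod (chi \<alpha> \<beta> \<aa>) (chi \<beta> \<gamma> \<bb>)"
    unfolding ab a b lrel_prod_def by (rule S.chi_mat_star)
  moreover have "eta \<alpha> \<gamma> (star \<alpha> \<beta> \<gamma> \<aa> \<bb>) = eta \<alpha> \<beta> \<aa> + eta \<beta> \<gamma> \<bb> +
      quot_dim (lrel_indef (chi \<beta> \<gamma> \<bb>)) (lrel_indef (chi \<beta> \<gamma> \<bb>) \<inter> Domain (chi \<alpha> \<beta> \<aa>))"
    unfolding ab a b by (rule S.eta_mat_star)
  moreover have "chi \<beta> \<alpha> (star_inv \<alpha> \<beta> \<aa>) = (chi \<alpha> \<beta> \<aa>)\<inverse>"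
    unfolding inv a0 chi_dcoset[OF assms(2,1) fi] by (rule chi_mat_inverse[OF A0(1)])
  moreover have "int (eta \<beta> \<alpha> (star_inv \<alpha> \<beta> \<aa>)) =
      int (eta \<alpha> \<beta> \<aa>) + int (col.dim (lrel_indef (chi \<alpha> \<beta> \<aa>)))
        - int (col.dim (lrel_ker (chi \<alpha> \<beta> \<aa>))) - fst \<beta> + fst \<alpha>"
    unfolding inv a0 eta_dcoset[OF assms(2,1) fi] by (rule eta_mat_inverse[OF A0(1) assms(1,2)])
  ultimately show ?thesis by blast
qed

end
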